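(* Let $\mathcal A$ be a commutative semiring, $n\ge 2$, $V_n$ the free $\mathcal A$-module with basis $b_0,\dots,b_{n-1}$, $f\in\operatorname{End}_{\mathcal A}(V_n)$, $D(z)$ the Hasse–Schmidt derivation on $\bigwedge V_n$ associated with $f$, and $\overline D(z)$ its quasi-inverse (all as described in the context). Then for all $u,v\in\bigwedge^{>0}V_n=\bigoplus_{r\ge1}\bigwedge^rV_n$, $$\overline D(z)\bigl(D(z)u\wedge v\bigr)\ \succeq\ u\wedge \overline D(z)v .$$
   Context: Grassmann semialgebra. $\bigwedge V_n=\bigoplus_{r\ge0}\bigwedge^rV_n$ is the graded associative $\mathcal A$-semialgebra with product $\wedge$ such that $\bigwedge^0V_n=\mathcal A$, $\bigwedge^1V_n=V_n$, and for $r\ge2$, $\bigwedge^rV_n$ is the free $\mathcal A$-module with basis $\{b_I,b_I': I\subseteq\{0,\dots,n-1\},|I|=r\}$ (rank $2\binom nr$; zero if $r>n$), where $b_I=b_{i_1}\wedge\cdots\wedge b_{i_r}$ for $I=\{i_1<\dots<i_r\}$. On each $\bigwedge^rV_n$, $r\ge2$, the negation map $(-)$ is the $\mathcal A$-linear involution exchanging $b_I$ and $b_I'$; it is compatible with $\wedge$ ($((-)x)\wedge y=x\wedge((-)y)=(-)(x\wedge y)$ in degrees $\ge2$), $b_i\wedge b_i=\mathbb 0$, and $u\wedge w=(-)(w\wedge u)$ for $u,w\in V_n$. Hence a product $b_{j_1}\wedge\cdots\wedge b_{j_r}$ is $\mathbb 0$ if two indices coincide, and otherwise equals $b_I$ or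 $b_I'=(-)b_I$ according as the permutation sorting $(j_1,\dots,j_r)$ increasingly is even or odd. Write $x(-)y:=x+((-)y)$ and $(-)^j$ for the $j$-fold application of $(-)$. A quasi-zero is an element $x(-)x$. For $x,y$ of the same degree $\ge2$, $x\succeq y$ means $x=y+d$ with $d$ in the ideal generated by the quasi-zeros and all $w\wedge w$, $w\in V_n$; for power series in $z$ with such coefficients, $\succeq$ is meant coefficientwise. Hasse–Schmidt derivation. $D(z)=\sum_{i\ge0}D_iz^i$ with $D_i\in\operatorname{End}_{\mathcal A}(\bigwedge V_n)$ preserving each $\bigwedge^rV_n$, $D(z)(u\wedge v)=D(z)u\wedge D(z)v$ (i.e. $D_k(u\wedge v)=\sum_{i+j=k}D_iu\wedge D_jv$), and $D_iv=f^i(v)$ for $v\in V_n$; thus $D(z)(u_1\wedge\cdots\wedge u_r)=D(z)u_1\wedge\cdots\wedge D(z)u_r$ with $D(z)u_k=\sum_i f^i(u_k)z^i$, and $D_1=f$ on $V_n$. Operators act on power series in $z$ coefficientwise. Quasi-inverse. For $r\ge2$ and $u_1,\dots,u_r\in V_n$, $\overline D(z)(u_1\wedge\cdots\wedge u_r)=\sum_{j=0}^r z^j\,(-)^j\sum_{S\subseteq\{1,\dots,r\},|S|=j}u_1^S\wedge\cdots\wedge u_r^S$, where $u_k^S=f(u_k)$ if $k\in S$ and $u_k^S=u_k$ otherwise, extended additively; e.g. $\overline D(z)(u\wedge v)=u\wedge v+(f(v)\wedge u+v\wedge f(u))z+(f(u)\wedge f(v))z^2$. Write $\overline D(z)=\sum_j\overline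 D_jz^j$. For $u\in\bigwedge^{\ge1}V_n$ and $v=v_1\wedge\cdots\wedge v_s$ ($s\ge1$, $v_k\in V_n$), $u\wedge\overline D(z)v:=\sum_{j}z^j(-)^j\sum_{|S|=j}u\wedge v_1^S\wedge\cdots\wedge v_s^S$ (for $s\ge2$ this is $u\wedge(\overline D(z)v)$; for $s=1$ it is $u\wedge v+z\,(-)(u\wedge f(v))$), extended additively in $v$.
   Formalization: D(z) and its quasi-inverse are taken as the linear maps given by their formulas on the basis elements b_I, b_I' only; demanding the formulas for all products is inconsistent (b_0∧b_0=0, yet with f(b_0)=b_1 the rule gives D_1(b_0∧b_0)=b_I+b_I'≠0). *)

theory Defs
  imports Main "HOL-Library.Function_Algebras"
begin

text \<open>An element of the Grassmann semialgebra is represented by its coefficient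
function on basis keys.  A key (I, p) with I a finite set of indices stands for
b_I (p = False) or b_I' (p = True).  Degree 0 is the key ({}, False) (the unit),
degree 1 the keys ({i}, False) = b_i; primed keys only exist for card I \<ge> 2.\<close>

type_synonym 'a ext = "nat set \<times> bool \<Rightarrow> 'a"
type_synonym 'a vect = "nat \<Rightarrow> 'a"

definition gkeys :: "nat \<Rightarrow> (nat set \<times> bool) set" where
  "gkeys n = {(I, p). I \<subseteq> {..<n} \<and> (p \<longrightarrow> 2 \<le> card I)}"

definition gwf :: "nat \<Rightarrow> 'a::zero ext \<Rightarrow> bool" where
  "gwf n x \<longleftrightarrow> (\<forall>K. K \<notin> gkeys n \<longrightarrow> x K = 0)"

definition vin :: "nat \<Rightarrow> 'a::zero vect \<Rightarrow> bool" where
  "vin n v \<longleftrightarrow> (\<forall>i\<ge>n. v i = 0)"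

definition bv :: "nat \<Rightarrow> 'a::{zero,one} vect" where
  "bv i = (\<lambda>j. if j = i then 1 else 0)"

definition endo :: "nat \<Rightarrow> ('a::comm_semiring_1 vect \<Rightarrow> 'a vect) \<Rightarrow> bool" where
  "endo n f \<longleftrightarrow> (\<forall>v. vin n v \<longrightarrow> vin n (f v))
     \<and> (\<forall>v w. vin n v \<longrightarrow> vin n w \<longrightarrow> f (v + w) = f v + f w)
     \<and> (\<forall>c v. vin n v \<longrightarrow> f (\<lambda>i. c * v i) = (\<lambda>i. c * f v i))"

definition vec :: "'a::zero vect \<Rightarrow> 'a ext" where
  "vec v = (\<lambda>(I, p). if \<not> p \<and> card I = 1 then v (Min I) else 0)"

definition vpart :: "'a ext \<Rightarrow> 'a vect" where
  "vpart x = (\<lambda>i. x ({i}, False))"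

definition gone :: "'a::{zero,one} ext" where
  "gone = (\<lambda>(I, p). if I = {} \<and> \<not> p then 1 else 0)"

definition smult :: "'a::times \<Rightarrow> 'a ext \<Rightarrow> 'a ext" where
  "smult c x = (\<lambda>K. c * x K)"

definition neg :: "'a ext \<Rightarrow> 'a ext" where
  "neg x = (\<lambda>(I, p). if 2 \<le> card I then x (I, \<not> p) else x (I, p))"

definition negp :: "bool \<Rightarrow> 'a ext \<Rightarrow> 'a ext" where
  "negp p x = (if p then neg x else x)"

text \<open>number of inversions of the concatenation of the increasing lists of I and J\<close>
definition ninv :: "nat set \<Rightarrow> nat set \<Rightarrow> nat" where
  "ninv I J = card {(i, j). i \<in> I \<and> j \<in> J \<and> j < i}"

text \<open>the wedge product, bilinear extension of
  b_I \<and> b_J = 0 if I, J meet, = b_(I\<union>J) or its negation according to the sign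
  of the sorting permutation\<close>
definition wedge :: "'a::comm_semiring_1 ext \<Rightarrow> 'a ext \<Rightarrow> 'a ext" where
  "wedge x y = (\<lambda>(K, r). \<Sum>I\<in>Pow K. \<Sum>p\<in>UNIV. \<Sum>q\<in>UNIV.
      if (p \<noteq> q) = (r \<noteq> odd (ninv I (K - I))) then x (I, p) * y (K - I, q) else 0)"

definition wedge_list :: "'a::comm_semiring_1 vect list \<Rightarrow> 'a ext" where
  "wedge_list us = foldr (\<lambda>u acc. wedge (vec u) acc) us gone"

definition basis_list :: "nat set \<Rightarrow> 'a::{zero,one} vect list" where
  "basis_list I = map bv (sorted_list_of_set I)"

text \<open>HS f k [u_1,...,u_r] = D_k (u_1 \<and> ... \<and> u_r)
   = sum over i_1+...+i_r = k of f^i_1 u_1 \<and> ... \<and> f^i_r u_r\<close>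
fun HS :: "('a::comm_semiring_1 vect \<Rightarrow> 'a vect) \<Rightarrow> nat \<Rightarrow> 'a vect list \<Rightarrow> 'a ext" where
  "HS f k [] = (if k = 0 then gone else 0)"
| "HS f k (u # us) = (\<Sum>i\<le>k. wedge (vec ((f ^^ i) u)) (HS f (k - i) us))"

definition Dk :: "nat \<Rightarrow> ('a::comm_semiring_1 vect \<Rightarrow> 'a vect) \<Rightarrow> nat \<Rightarrow> 'a ext \<Rightarrow> 'a ext" where
  "Dk n f k x = (\<Sum>K\<in>gkeys n. smult (x K) (negp (snd K) (HS f k (basis_list (fst K)))))"

definition Qbar :: "('a::comm_semiring_1 vect \<Rightarrow> 'a vect) \<Rightarrow> nat \<Rightarrow> 'a vect list \<Rightarrow> 'a ext" where
  "Qbar f j us = (neg ^^ j)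
     (\<Sum>S\<in>{S. S \<subseteq> {..<length us} \<and> card S = j}.
        wedge_list (map (\<lambda>k. if k \<in> S then f (us ! k) else us ! k) [0..<length us]))"

text \<open>Dbar_j, the A-linear extension on degrees \<ge> 2 (components of degree < 2 are dropped)\<close>
definition Dbar :: "nat \<Rightarrow> ('a::comm_semiring_1 vect \<Rightarrow> 'a vect) \<Rightarrow> nat \<Rightarrow> 'a ext \<Rightarrow> 'a ext" where
  "Dbar n f j x = (\<Sum>K\<in>{K \<in> gkeys n. 2 \<le> card (fst K)}.
      smult (x K) (negp (snd K) (Qbar f j (basis_list (fst K)))))"

text \<open>z^k-coefficient of  Dbar(z) (D(z) u \<and> v)\<close>
definition lhs_coeff :: "nat \<Rightarrow> ('a::comm_semiring_1 vect \<Rightarrow> 'a vect) \<Rightarrow> 'a ext \<Rightarrow> 'a ext \<Rightarrow> nat \<Rightarrow> 'a ext" where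
  "lhs_coeff n f u v k = (\<Sum>j\<le>k. Dbar n f j (wedge (Dk n f (k - j) u) v))"

text \<open>z^k-coefficient of  u \<and> Dbar(z) v : for the degree \<ge> 2 part of v this is
  u \<and> Dbar_k v, for the degree-1 part v_1 it is u \<and> v_1 + z (-)(u \<and> f(v_1))\<close>
definition rhs_coeff :: "nat \<Rightarrow> ('a::comm_semiring_1 vect \<Rightarrow> 'a vect) \<Rightarrow> 'a ext \<Rightarrow> 'a ext \<Rightarrow> nat \<Rightarrow> 'a ext" where
  "rhs_coeff n f u v k = wedge u (Dbar n f k v)
     + (if k = 0 then wedge u (vec (vpart v))
        else if k = 1 then neg (wedge u (vec (f (vpart v))))
        else 0)"

definition high :: "'a::zero ext \<Rightarrow> bool" where
  "high x \<longleftrightarrow> (\<forall>I p. card I < 2 \<longrightarrow> x (I, p) = 0)"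

definition qgens :: "nat \<Rightarrow> 'a::comm_semiring_1 ext set" where
  "qgens n = {x + neg x | x. gwf n x \<and> high x}
           \<union> {wedge (vec w) (vec w) | w. vin n w}"

inductive_set qideal :: "nat \<Rightarrow> 'a::comm_semiring_1 ext set" for n where
  qzero: "0 \<in> qideal n"
| qgen: "g \<in> qgens n \<Longrightarrow> gwf n a \<Longrightarrow> gwf n b \<Longrightarrow> wedge (wedge a g) b \<in> qideal n"
| qadd: "x \<in> qideal n \<Longrightarrow> y \<in> qideal n \<Longrightarrow> x + y \<in> qideal n"

definition succeq :: "nat \<Rightarrow> 'a::comm_semiring_1 ext \<Rightarrow> 'a ext \<Rightarrow> bool" where
  "succeq n x y \<longleftrightarrow> (\<exists>d\<in>qideal n. x = y + d)"

end

theory Submission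
  imports Defs "HOL-Library.Poly_Mapping" "HOL-Library.Multiset" "HOL-Library.Disjoint_Sets"
begin

text \<open>
  By bilinearity \<open>u\<close> and \<open>v\<close> may be taken to be basis elements. In the classical exterior algebra
  both sides agree: the quasi-inverse is multiplicative there, and
  \<open>\<Sum>\<^sub>i z\<^sup>i (f\<^sup>i u - z f\<^sup>i\<^sup>+\<^sup>1 u)\<close> telescopes to \<open>u\<close>. This only gives \<open>LHS + d = RHS + e\<close> with
  quasi-zeros \<open>d\<close> and \<open>e\<close>, and \<open>d\<close> cannot be cancelled over a general semiring. Therefore \<open>f\<close> is
  first replaced by a generic matrix over the polynomial semiring in its entries with natural
  coefficients. There every monomial of the right-hand side occurs at exactly one basis key,
  because the columns occurring in it say which factors \<open>f\<close> was applied to. So no monomial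
  appears with both signs, the equality of differences forces \<open>LHS = RHS + quasi-zero\<close>,
  and this specialises to every \<open>f\<close>.
\<close>

subsection \<open>Functions with restricted support\<close>

definition supported :: "'k set \<Rightarrow> ('k \<Rightarrow> 'a::zero) \<Rightarrow> bool" where
  "supported A x \<longleftrightarrow> (\<forall>K. K \<notin> A \<longrightarrow> x K = 0)"

lemma supportedD: "supported A x \<Longrightarrow> x K \<noteq> 0 \<Longrightarrow> K \<in> A"
  by (auto simp: supported_def)

lemma supported_mono: "supported A x \<Longrightarrow> A \<subseteq> B \<Longrightarrow> supported B x"
  by (auto simp: supported_def)

lemma supported_zero [simp]: "supported A 0"
  by (simp add: supported_def)

lemma supported_add: "supported A x \<Longrightarrow> supported A y \<Longrightarrow> supported A (x + y)"
  for x y :: "'k \<Rightarrow> 'a::monoid_add"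
  by (simp add: supported_def)

lemma supported_sum: "(\<And>i. i \<in> S \<Longrightarrow> supported A (g i)) \<Longrightarrow> supported A (\<Sum>i\<in>S. g i)"
  for g :: "'i \<Rightarrow> 'k \<Rightarrow> 'a::comm_monoid_add"
  by (induction S rule: infinite_finite_induct) (simp_all add: supported_add)

lemma supported_induct:
  fixes x :: "'k \<Rightarrow> 'a::comm_semiring_1"
  assumes "finite A" "supported A x" and zero: "P 0"
    and add: "\<And>x y. supported A x \<Longrightarrow> supported A y \<Longrightarrow> P x \<Longrightarrow> P y \<Longrightarrow> P (x + y)"
    and unit: "\<And>c K. K \<in> A \<Longrightarrow> P (\<lambda>L. c * (if L = K then 1 else 0))"
  shows "P x"
proof -
  have "P x" if "finite B" "supported B x" "B \<subseteq> A" for B x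
    using that
  proof (induction B arbitrary: x rule: finite_induct)
    case empty
    then have "x = 0" by (simp add: supported_def fun_eq_iff)
    then show ?case using zero by (simp only:)
  next
    case (insert K B)
    let ?y = "x(K := 0)" and ?z = "\<lambda>L. x K * (if L = K then 1 else 0)"
    have y: "supported B ?y" and z: "supported {K} ?z"
      using insert.prems by (auto simp: supported_def)
    have "P ?y" using insert.IH[OF y] insert.prems by blast
    then have "P (?y + ?z)"
      using insert.prems by (intro add unit supported_mono[OF y] supported_mono[OF z]) auto
    moreover have "x = ?y + ?z" by auto
    ultimately show ?case by simp
  qed
  then show ?thesis using assms(1,2) by blast
qed

lemma sum_fun_apply: "(\<Sum>i\<in>A. g i) K = (\<Sum>i\<in>A. g i K)"
  for g :: "'i \<Rightarrow> 'k \<Rightarrow> 'a::comm_monoid_add"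
  by (induction A rule: infinite_finite_induct) auto

subsection \<open>Signs and degrees\<close>

text \<open>Unlike \<open>neg\<close>, the map \<open>twist True\<close> exchanges the two signs in degrees 0 and 1 as well; it
  commutes with \<open>wedge\<close> in every degree, at the price of leaving the set of well-formed elements.\<close>

definition twist :: "bool \<Rightarrow> 'a ext \<Rightarrow> 'a ext" where
  "twist p x = (\<lambda>(I, q). x (I, p \<noteq> q))"

lemma twist_apply [simp]: "twist p x (I, q) = x (I, p \<noteq> q)"
  by (simp add: twist_def)

lemma twist_False [simp]: "twist False x = x"
  by (simp add: twist_def)

lemma twist_twist [simp]: "twist p (twist q x) = twist (p \<noteq> q) x"
  by (cases p; cases q) (simp_all add: twist_def)

lemma twist_zero [simp]: "twist p 0 = 0"
  by (auto simp: twist_def)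

lemma twist_add: "twist p (x + y) = twist p x + twist p y"
  by (auto simp: twist_def)

lemma twist_sum: "twist p (\<Sum>i\<in>A. g i) = (\<Sum>i\<in>A. twist p (g i))"
  by (auto simp: fun_eq_iff sum_fun_apply)

lemma smult_apply [simp]: "smult c x K = c * x K"
  by (simp add: smult_def)

lemma smult_zero_left [simp]: "smult 0 x = 0" for x :: "'a::comm_semiring_1 ext"
  by (auto simp: fun_eq_iff)

lemma smult_one [simp]: "smult 1 x = x" for x :: "'a::comm_semiring_1 ext"
  by (auto simp: fun_eq_iff)

lemma smult_add_left: "smult (c + d) x = smult c x + smult d x" for c :: "'a::comm_semiring_1"
  by (auto simp: fun_eq_iff algebra_simps)

lemma smult_add_right: "smult c (x + y) = smult c x + smult c y" for c :: "'a::comm_semiring_1"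
  by (auto simp: fun_eq_iff algebra_simps)

lemma smult_sum: "smult c (\<Sum>i\<in>A. g i) = (\<Sum>i\<in>A. smult c (g i))" for c :: "'a::comm_semiring_1"
  by (auto simp: fun_eq_iff sum_fun_apply sum_distrib_left)

lemma smult_smult: "smult c (smult d x) = smult (c * d) x" for c :: "'a::comm_semiring_1"
  by (auto simp: fun_eq_iff algebra_simps)

lemma twist_smult: "twist p (smult c x) = smult c (twist p x)"
  by (auto simp: fun_eq_iff)

definition dkeys :: "nat \<Rightarrow> nat set \<Rightarrow> (nat set \<times> bool) set" where
  "dkeys n D = {(I, p). I \<subseteq> {..<n} \<and> card I \<in> D}"

lemma in_dkeys_iff [simp]: "(I, p) \<in> dkeys n D \<longleftrightarrow> I \<subseteq> {..<n} \<and> card I \<in> D"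
  by (simp add: dkeys_def)

lemma dkeys_mono: "D \<subseteq> E \<Longrightarrow> dkeys n D \<subseteq> dkeys n E"
  by auto

lemma finite_dkeys [simp]: "finite (dkeys n D)"
  by (rule finite_subset[of _ "Pow {..<n} \<times> UNIV"]) auto

lemma supported_dkeys_mono: "supported (dkeys n D) x \<Longrightarrow> D \<subseteq> E \<Longrightarrow> supported (dkeys n E) x"
  by (rule supported_mono[OF _ dkeys_mono])

lemma supported_dkeys_infinite:
  assumes "supported (dkeys n D) x" "infinite K"
  shows "x (K, p) = 0"
proof -
  have "\<not> K \<subseteq> {..<n}" using assms(2) finite_subset by blast
  then show ?thesis using assms(1) by (simp add: supported_def)
qed

lemma supported_twist [simp]: "supported (dkeys n D) (twist p x) \<longleftrightarrow> supported (dkeys n D) x"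
  by (cases p) (auto simp: supported_def all_bool_eq)

lemma supported_smult: "supported A x \<Longrightarrow> supported A (smult c x)" for c :: "'a::comm_semiring_1"
  by (simp add: supported_def)

lemma neg_eq_twist: "supported (dkeys n {2..}) x \<Longrightarrow> neg x = twist True x"
  by (auto simp: neg_def twist_def supported_def fun_eq_iff)

lemma negp_eq_twist: "supported (dkeys n D) x \<Longrightarrow> (p \<Longrightarrow> D \<subseteq> {2..}) \<Longrightarrow> negp p x = twist p x"
  using neg_eq_twist[OF supported_dkeys_mono] by (cases p) (auto simp: negp_def)

lemma funpow_neg_eq_twist:
  assumes "supported (dkeys n {2..}) x"
  shows "(neg ^^ j) x = twist (odd j) x"
proof (induction j)
  case (Suc j)
  have "(neg ^^ Suc j) x = neg (twist (odd j) x)" using Suc.IH by simp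
  also have "\<dots> = twist True (twist (odd j) x)" using assms by (intro neg_eq_twist) simp
  finally show ?case by simp
qed simp

lemma supported_vec: "vin n w \<Longrightarrow> supported (dkeys n {1}) (vec w)"
  unfolding supported_def vec_def vin_def by (auto simp: card_1_singleton_iff) (meson not_le)

lemma vec_zero [simp]: "vec 0 = 0"
  by (auto simp: vec_def)

lemma vec_add: "vec (v + w) = vec v + vec w" for v w :: "'a::comm_semiring_1 vect"
  by (auto simp: vec_def)

lemma vec_smult: "vec (\<lambda>i. c * w i) = smult c (vec w)" for w :: "'a::comm_semiring_1 vect"
  by (auto simp: vec_def fun_eq_iff)

definition basis_ext :: "nat set \<times> bool \<Rightarrow> 'a::{zero,one} ext" where
  "basis_ext K = (\<lambda>L. if L = K then 1 else 0)"

lemma supported_basis_ext: "K \<in> A \<Longrightarrow> supported A (basis_ext K)"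
  by (auto simp: supported_def basis_ext_def)

lemma twist_basis_ext: "twist p (basis_ext (I, q)) = basis_ext (I, p \<noteq> q)"
  by (auto simp: basis_ext_def fun_eq_iff)

lemma gone_eq_basis_ext: "gone = basis_ext ({}, False)"
  by (auto simp: gone_def basis_ext_def fun_eq_iff)

lemma vec_bv: "vec (bv i) = basis_ext ({i}, False)"
  by (auto simp: vec_def bv_def basis_ext_def fun_eq_iff card_1_singleton_iff)

lemma ext_induct [consumes 1, case_names zero add smult_basis]:
  fixes x :: "'a::comm_semiring_1 ext"
  assumes "supported (dkeys n D) x" "P 0"
    and "\<And>x y. supported (dkeys n D) x \<Longrightarrow> supported (dkeys n D) y \<Longrightarrow> P x \<Longrightarrow> P y \<Longrightarrow> P (x + y)"
    and "\<And>c K. K \<in> dkeys n D \<Longrightarrow> P (smult c (basis_ext K))"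
  shows "P x"
  by (rule supported_induct[OF finite_dkeys assms(1-3)])
    (use assms(4) in \<open>simp_all add: smult_def basis_ext_def\<close>)

lemma vin_induct [consumes 1, case_names zero add smult_bv]:
  fixes w :: "'a::comm_semiring_1 vect"
  assumes "vin n w" "P 0"
    and "\<And>v w. vin n v \<Longrightarrow> vin n w \<Longrightarrow> P v \<Longrightarrow> P w \<Longrightarrow> P (v + w)"
    and "\<And>c i. i < n \<Longrightarrow> P (\<lambda>l. c * bv i l)"
  shows "P w"
proof -
  have vin: "vin n v \<longleftrightarrow> supported {..<n} v" for v :: "'a vect"
    by (auto simp: vin_def supported_def)
  show ?thesis
    by (rule supported_induct[OF finite_lessThan assms(1)[unfolded vin] assms(2)
      assms(3)[unfolded vin]])
      (use assms(4) in \<open>simp_all add: bv_def\<close>)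
qed

lemma endo_add: "endo n f \<Longrightarrow> vin n v \<Longrightarrow> vin n w \<Longrightarrow> f (v + w) = f v + f w"
  by (simp add: endo_def)

lemma endo_smult: "endo n f \<Longrightarrow> vin n v \<Longrightarrow> f (\<lambda>i. c * v i) = (\<lambda>i. c * f v i)"
  by (simp add: endo_def)

lemma endo_zero: "endo n f \<Longrightarrow> f 0 = 0"
  using endo_smult[of n f 0 0] by (simp add: vin_def zero_fun_def)

lemma vin_endo: "endo n f \<Longrightarrow> vin n w \<Longrightarrow> vin n (f w)"
  by (simp add: endo_def)

lemma vin_funpow_endo: "endo n f \<Longrightarrow> vin n w \<Longrightarrow> vin n ((f ^^ i) w)"
  by (induction i) (simp_all add: vin_endo)

lemma vin_bv: "i < n \<Longrightarrow> vin n (bv i)"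
  by (auto simp: vin_def bv_def)

lemma length_basis_list [simp]: "length (basis_list I) = card I"
  by (simp add: basis_list_def)

lemma vin_basis_list: "I \<subseteq> {..<n} \<Longrightarrow> u \<in> set (basis_list I) \<Longrightarrow> vin n u"
  using finite_subset[of I "{..<n}"] by (auto simp: basis_list_def intro!: vin_bv)

subsection \<open>The wedge product\<close>

lemma wedge_apply:
  "wedge x y (K, r) = (\<Sum>I\<in>Pow K. \<Sum>p\<in>UNIV. x (I, p) * y (K - I, p \<noteq> (r \<noteq> odd (ninv I (K - I)))))"
  unfolding wedge_def by (auto simp: UNIV_bool intro!: sum.cong)

lemma wedge_apply_infinite: "infinite K \<Longrightarrow> wedge x y (K, r) = 0"
  by (simp add: wedge_apply)

lemma wedge_zero_left [simp]: "wedge 0 y = 0"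
  and wedge_zero_right [simp]: "wedge x 0 = 0"
  by (auto simp: fun_eq_iff wedge_apply)

lemma wedge_add_left: "wedge (x + x') y = wedge x y + wedge x' y"
  and wedge_add_right: "wedge x (y + y') = wedge x y + wedge x y'"
  by (auto simp: fun_eq_iff wedge_apply algebra_simps sum.distrib)

lemma wedge_smult_left: "wedge (smult c x) y = smult c (wedge x y)"
  and wedge_smult_right: "wedge x (smult c y) = smult c (wedge x y)"
  by (auto simp: fun_eq_iff wedge_apply sum_distrib_left algebra_simps)

lemma wedge_sum_left: "wedge (\<Sum>i\<in>A. g i) y = (\<Sum>i\<in>A. wedge (g i) y)"
  using sum_comp_morphism[of "\<lambda>x. wedge x y" g A]
  by (simp only: wedge_add_left wedge_zero_left comp_def)

lemma wedge_sum_right: "wedge x (\<Sum>i\<in>A. g i) = (\<Sum>i\<in>A. wedge x (g i))"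
  using sum_comp_morphism[of "wedge x" g A]
  by (simp only: wedge_add_right wedge_zero_right comp_def)

lemma wedge_twist_left: "wedge (twist p x) y = twist p (wedge x y)"
  and wedge_twist_right: "wedge x (twist p y) = twist p (wedge x y)"
  by (cases p; auto simp: fun_eq_iff wedge_apply UNIV_bool add.commute intro!: sum.cong)+

lemma supported_wedge:
  assumes x: "supported (dkeys n D) x" and y: "supported (dkeys n E) y"
    and F: "\<And>d e. d \<in> D \<Longrightarrow> e \<in> E \<Longrightarrow> d + e \<in> F"
  shows "supported (dkeys n F) (wedge x y)"
proof -
  have "x (I, p) * y (K - I, q) = 0" if K: "(K, r) \<notin> dkeys n F" and "I \<subseteq> K" for I K p q r
  proof (rule ccontr)
    assume "x (I, p) * y (K - I, q) \<noteq> 0"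
    then have "x (I, p) \<noteq> 0" "y (K - I, q) \<noteq> 0" by auto
    then have "(I, p) \<in> dkeys n D" "(K - I, q) \<in> dkeys n E"
      using supportedD[OF x] supportedD[OF y] by blast+
    then have "I \<subseteq> {..<n}" "K - I \<subseteq> {..<n}" "card I + card (K - I) \<in> F" using F by auto
    moreover have "card (I \<union> (K - I)) = card I + card (K - I)"
      using calculation finite_subset by (intro card_Un_disjoint) auto
    moreover have "I \<union> (K - I) = K" using \<open>I \<subseteq> K\<close> by blast
    ultimately show False using K by auto
  qed
  then show ?thesis by (auto simp: supported_def wedge_apply intro!: sum.neutral)
qed

lemma ninv_eq_sum:
  assumes "finite I" "finite J"
  shows "ninv I J = (\<Sum>i\<in>I. \<Sum>j\<in>J. of_bool (j < i))"
proof -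
  have "{(i, j). i \<in> I \<and> j \<in> J \<and> j < i} = {K \<in> I \<times> J. snd K < fst K}" by auto
  then have "ninv I J = (\<Sum>K\<in>I \<times> J. of_bool (snd K < fst K))"
    using assms by (simp add: ninv_def sum.If_cases of_bool_def Int_def)
  then show ?thesis by (simp add: sum.cartesian_product case_prod_unfold)
qed

lemma ninv_empty [simp]: "ninv {} J = 0" "ninv I {} = 0"
  by (simp_all add: ninv_def)

lemma ninv_singleton: "finite J \<Longrightarrow> ninv {i} J = card {j \<in> J. j < i}"
  by (simp add: ninv_eq_sum of_bool_def sum.If_cases Int_def)

lemma ninv_Un_left:
  "finite I \<Longrightarrow> finite J \<Longrightarrow> finite L \<Longrightarrow> I \<inter> J = {}
    \<Longrightarrow> ninv (I \<union> J) L = ninv I L + ninv J L"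
  by (simp add: ninv_eq_sum sum.union_disjoint)

lemma ninv_Un_right:
  "finite I \<Longrightarrow> finite J \<Longrightarrow> finite L \<Longrightarrow> J \<inter> L = {}
    \<Longrightarrow> ninv I (J \<union> L) = ninv I J + ninv I L"
  by (simp add: ninv_eq_sum sum.union_disjoint sum.distrib del: sum_of_bool_eq)

lemma ninv_add_swap:
  assumes "finite I" "finite J" "I \<inter> J = {}"
  shows "ninv I J + ninv J I = card I * card J"
proof -
  have "ninv J I = (\<Sum>i\<in>I. \<Sum>j\<in>J. of_bool (i < j))"
    unfolding ninv_eq_sum[OF assms(2,1)] by (rule sum.swap)
  then have "ninv I J + ninv J I = (\<Sum>i\<in>I. \<Sum>j\<in>J. of_bool (j < i) + of_bool (i < j))"
    using assms by (simp add: ninv_eq_sum sum.distrib del: sum_of_bool_eq)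
  also have "\<dots> = (\<Sum>i\<in>I. \<Sum>j\<in>J. 1)"
    using assms(3) by (intro sum.cong refl) (auto simp: of_bool_def)
  finally show ?thesis by simp
qed

lemma sum_Pow_Pow:
  assumes "finite K"
  shows "(\<Sum>M\<in>Pow K. \<Sum>I\<in>Pow M. g I M) = (\<Sum>I\<in>Pow K. \<Sum>J\<in>Pow (K - I). g I (I \<union> J))"
proof -
  have "(\<Sum>M\<in>Pow K. \<Sum>I\<in>Pow M. g I M) = (\<Sum>(M, I)\<in>(SIGMA M:Pow K. Pow M). g I M)"
    using assms by (intro sum.Sigma) (auto intro: finite_subset)
  also have "\<dots> = (\<Sum>(I, J)\<in>(SIGMA I:Pow K. Pow (K - I)). g I (I \<union> J))"
    by (rule sum.reindex_bij_witness[of _ "\<lambda>(I, J). (I \<union> J, I)" "\<lambda>(M, I). (I, M - I)"])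
       (auto simp: Un_absorb1)
  also have "\<dots> = (\<Sum>I\<in>Pow K. \<Sum>J\<in>Pow (K - I). g I (I \<union> J))"
    using assms by (intro sum.Sigma[symmetric]) (auto intro: finite_subset)
  finally show ?thesis .
qed

lemma sum_bool_xor_assoc:
  fixes X Y Z :: "bool \<Rightarrow> 'a::comm_semiring_1"
  shows "(\<Sum>p\<in>UNIV. \<Sum>s\<in>UNIV. X s * Y (s \<noteq> (p \<noteq> a)) * Z (p \<noteq> (r \<noteq> (b \<noteq> c))))
    = (\<Sum>s\<in>UNIV. \<Sum>t\<in>UNIV. X s * (Y t * Z (t \<noteq> ((s \<noteq> (r \<noteq> (a \<noteq> b))) \<noteq> c))))"
  by (cases a; cases b; cases c; cases r; simp add: UNIV_bool ac_simps)

lemma wedge_assoc: "wedge (wedge x y) z = wedge x (wedge y z)"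
proof (rule ext, clarify)
  fix K r
  show "wedge (wedge x y) z (K, r) = wedge x (wedge y z) (K, r)"
  proof (cases "finite K")
    case True
    define left_term where "left_term I M = (\<Sum>p\<in>UNIV. \<Sum>s\<in>UNIV. x (I, s)
      * y (M - I, s \<noteq> (p \<noteq> odd (ninv I (M - I))))
      * z (K - M, p \<noteq> (r \<noteq> odd (ninv M (K - M)))))" for I M
    define right_term where "right_term I J = (\<Sum>s\<in>UNIV. \<Sum>t\<in>UNIV. x (I, s) * (y (J, t)
      * z (K - I - J, t \<noteq> ((s \<noteq> (r \<noteq> odd (ninv I (K - I)))) \<noteq> odd (ninv J (K - I - J))))))" for I J
    have terms_eq: "left_term I (I \<union> J) = right_term I J" if "I \<subseteq> K" "J \<subseteq> K - I" for I J
    proof -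
      define L where "L = K - I - J"
      have "finite I" "finite J" "finite L"
        using that True by (auto simp: L_def intro: finite_subset)
      then have ninv: "ninv (I \<union> J) L = ninv I L + ninv J L" "ninv I (J \<union> L) = ninv I J + ninv I L"
        using that by (intro ninv_Un_left ninv_Un_right; auto simp: L_def)+
      have sets: "(I \<union> J) - I = J" "K - (I \<union> J) = L" "K - I = J \<union> L" "J \<union> L - J = L"
        using that by (auto simp: L_def)
      show ?thesis
        unfolding left_term_def right_term_def sets ninv odd_add by (rule sum_bool_xor_assoc)
    qed
    have "wedge (wedge x y) z (K, r) = (\<Sum>M\<in>Pow K. \<Sum>I\<in>Pow M. left_term I M)"
      unfolding wedge_apply left_term_def sum_distrib_right
      by (rule sum.cong[OF refl], rule sum.swap)
    also have "\<dots> = (\<Sum>I\<in>Pow K. \<Sum>J\<in>Pow (K - I). left_term I (I \<union> J))"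
      using True by (rule sum_Pow_Pow)
    also have "\<dots> = (\<Sum>I\<in>Pow K. \<Sum>J\<in>Pow (K - I). right_term I J)"
      using terms_eq by (intro sum.cong refl) auto
    also have "\<dots> = wedge x (wedge y z) (K, r)"
      unfolding wedge_apply right_term_def sum_distrib_left
      by (rule sum.cong[OF refl], rule sum.swap)
    finally show ?thesis .
  qed (simp add: wedge_apply_infinite)
qed

lemma sum_bool_xor_commute:
  fixes X Y :: "bool \<Rightarrow> 'a::comm_semiring_1"
  shows "(\<Sum>p\<in>UNIV. X p * Y (p \<noteq> s)) = (\<Sum>p\<in>UNIV. Y p * X (p \<noteq> s))"
  by (cases s) (simp_all add: UNIV_bool ac_simps)

lemma wedge_commute:
  assumes x: "\<And>I p. x (I, p) \<noteq> 0 \<Longrightarrow> card I = d" and y: "\<And>J q. y (J, q) \<noteq> 0 \<Longrightarrow> card J = e"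
  shows "wedge x y = twist (odd (d * e)) (wedge y x)"
proof (rule ext, clarify)
  fix K r
  show "wedge x y (K, r) = twist (odd (d * e)) (wedge y x) (K, r)"
  proof (cases "finite K")
    case True
    have inner_sum: "(\<Sum>p\<in>UNIV. x (K - J, p) * y (J, p \<noteq> (r \<noteq> odd (ninv (K - J) J))))
      = (\<Sum>p\<in>UNIV. y (J, p) * x (K - J, p \<noteq> ((odd (d * e) \<noteq> r) \<noteq> odd (ninv J (K - J)))))"
      if "J \<subseteq> K" for J
    proof (cases "card (K - J) = d \<and> card J = e")
      case True
      then have "ninv (K - J) J + ninv J (K - J) = d * e"
        using ninv_add_swap[of "K - J" J] that \<open>finite K\<close> finite_subset by auto
      then have "odd (d * e) = (odd (ninv (K - J) J) \<noteq> odd (ninv J (K - J)))" by (metis odd_add)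
      then have "((odd (d * e) \<noteq> r) \<noteq> odd (ninv J (K - J))) = (r \<noteq> odd (ninv (K - J) J))" by blast
      then show ?thesis by (simp only:) (rule sum_bool_xor_commute)
    next
      case False
      then have "x (K - J, p) * y (J, q) = 0" "y (J, q) * x (K - J, p) = 0" for p q
        using x y by (metis mult_zero_left mult_zero_right)+
      then show ?thesis by simp
    qed
    have "wedge x y (K, r) = (\<Sum>J\<in>Pow K. \<Sum>p\<in>UNIV. x (K - J, p)
        * y (J, p \<noteq> (r \<noteq> odd (ninv (K - J) J))))"
      unfolding wedge_apply
      by (rule sum.reindex_bij_witness[of _ "\<lambda>J. K - J" "\<lambda>I. K - I"]) (auto simp: double_diff)
    also have "\<dots> = twist (odd (d * e)) (wedge y x) (K, r)"
      unfolding twist_apply wedge_apply by (rule sum.cong[OF refl], rule inner_sum) simp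
    finally show ?thesis .
  qed (simp add: wedge_apply_infinite)
qed

lemma vec_wedge_swap:
  "wedge (vec u) (wedge (vec w) x) = twist True (wedge (vec w) (wedge (vec u) x))"
proof -
  have "card I = 1" if "vec v (I, p) \<noteq> 0" for v :: "'a vect" and I p
    using that by (auto simp: vec_def split: if_splits)
  then have "wedge (vec u) (vec w) = twist True (wedge (vec w) (vec u))"
    using wedge_commute[of "vec u" 1 "vec w" 1] by simp
  then show ?thesis by (metis wedge_assoc wedge_twist_left)
qed

lemma basis_ext_wedge_apply:
  "wedge (basis_ext (I, p)) x (K, r)
      = (if finite K \<and> I \<subseteq> K then x (K - I, p \<noteq> (r \<noteq> odd (ninv I (K - I)))) else 0)"
proof (cases "finite K")
  case True
  have "wedge (basis_ext (I, p)) x (K, r)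
      = (\<Sum>J\<in>Pow K. if J = I then x (K - J, p \<noteq> (r \<noteq> odd (ninv J (K - J)))) else 0)"
    unfolding wedge_apply by (intro sum.cong) (auto simp: UNIV_bool basis_ext_def)
  then show ?thesis using True by (simp add: sum.delta)
qed (simp add: wedge_apply_infinite)

lemma basis_ext_wedge_basis_ext:
  assumes "finite I" "finite J"
  shows "wedge (basis_ext (I, p)) (basis_ext (J, q))
    = (if I \<inter> J = {} then basis_ext (I \<union> J, p \<noteq> (q \<noteq> odd (ninv I J)))
      else (0 :: 'a::comm_semiring_1 ext))"
proof (rule ext, clarify)
  fix K r
  have "finite K \<and> I \<subseteq> K \<and> K - I = J \<longleftrightarrow> I \<inter> J = {} \<and> K = I \<union> J"
    using assms by auto
  moreover have "K - I = J" if "I \<inter> J = {}" "K = I \<union> J" using that by auto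
  ultimately show "wedge (basis_ext (I, p)) (basis_ext (J, q)) (K, r)
    = (if I \<inter> J = {} then basis_ext (I \<union> J, p \<noteq> (q \<noteq> odd (ninv I J))) else (0 :: 'a ext)) (K, r)"
    unfolding basis_ext_wedge_apply by (auto simp: basis_ext_def)
qed

lemma wedge_gone_left: "supported (dkeys n D) x \<Longrightarrow> wedge gone x = x"
  using supported_dkeys_infinite
  by (fastforce simp: gone_eq_basis_ext basis_ext_wedge_apply fun_eq_iff)

lemma wedge_gone_right:
  assumes "supported (dkeys n D) x"
  shows "wedge x gone = x"
proof (rule ext, clarify)
  fix K r
  show "wedge x gone (K, r) = x (K, r)"
  proof (cases "finite K")
    case True
    have "wedge x gone (K, r) = (\<Sum>I\<in>Pow K. if I = K then x (I, r) else 0)"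
      unfolding wedge_apply by (intro sum.cong) (auto simp: gone_def UNIV_bool)
    then show ?thesis using True by (simp add: sum.delta)
  qed (simp add: supported_dkeys_infinite[OF assms] wedge_apply_infinite)
qed

subsection \<open>The quasi-inverse and the Hasse--Schmidt derivation\<close>

text \<open>As simplification rules these would also expand unapplied sums and multiples of functions.\<close>

declare plus_fun_apply [simp del] zero_fun_apply [simp del] smult_apply [simp del]

text \<open>The coefficients of \<open>(u (-) z f(u)) \<and> X(z)\<close> for a power series \<open>X\<close>.\<close>

definition bar_wedge ::
  "('a::comm_semiring_1 vect \<Rightarrow> 'a vect) \<Rightarrow> 'a vect \<Rightarrow> (nat \<Rightarrow> 'a ext) \<Rightarrow> nat \<Rightarrow> 'a ext" where
  "bar_wedge f u X j = wedge (vec u) (X j)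
     + (case j of 0 \<Rightarrow> 0 | Suc i \<Rightarrow> twist True (wedge (vec (f u)) (X i)))"

lemma bar_wedge_0: "bar_wedge f u X 0 = wedge (vec u) (X 0)"
  and bar_wedge_Suc:
    "bar_wedge f u X (Suc i) = wedge (vec u) (X (Suc i)) + twist True (wedge (vec (f u)) (X i))"
  by (simp_all add: bar_wedge_def)

lemma bar_wedge_zero_left: "f 0 = 0 \<Longrightarrow> bar_wedge f 0 X j = 0"
  by (cases j) (simp_all only: bar_wedge_0 bar_wedge_Suc vec_zero wedge_zero_left twist_zero
    add_0_left)

lemma bar_wedge_add_left:
  "f (v + w) = f v + f w \<Longrightarrow> bar_wedge f (v + w) X j = bar_wedge f v X j + bar_wedge f w X j"
  by (cases j) (simp_all only: bar_wedge_0 bar_wedge_Suc vec_add wedge_add_left twist_add ac_simps)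

lemma bar_wedge_smult_left:
  "f (\<lambda>i. c * w i) = (\<lambda>i. c * f w i) \<Longrightarrow> bar_wedge f (\<lambda>i. c * w i) X j = smult c (bar_wedge f w X j)"
  by (cases j) (simp_all only: bar_wedge_0 bar_wedge_Suc vec_smult wedge_smult_left twist_smult
    smult_add_right)

lemma bar_wedge_zero: "bar_wedge f u (\<lambda>_. 0) j = 0"
  by (cases j) (simp_all only: bar_wedge_0 bar_wedge_Suc wedge_zero_right twist_zero add_0_left)

lemma bar_wedge_add: "bar_wedge f u (\<lambda>i. X i + Y i) j = bar_wedge f u X j + bar_wedge f u Y j"
  by (cases j) (simp_all only: bar_wedge_0 bar_wedge_Suc wedge_add_right twist_add ac_simps)

lemma bar_wedge_smult: "bar_wedge f u (\<lambda>i. smult c (X i)) j = smult c (bar_wedge f u X j)"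
  by (cases j) (simp_all only: bar_wedge_0 bar_wedge_Suc wedge_smult_right twist_smult
    smult_add_right)

lemma bar_wedge_twist: "bar_wedge f u (\<lambda>i. twist p (X i)) j = twist p (bar_wedge f u X j)"
  by (cases p; cases j) (simp_all add: bar_wedge_0 bar_wedge_Suc wedge_twist_right twist_add)

lemma bar_wedge_swap:
  "bar_wedge f u (bar_wedge f w X) j = twist True (bar_wedge f w (bar_wedge f u X) j)"
proof -
  note swap = vec_wedge_swap[of w u] vec_wedge_swap[of w "f u"] vec_wedge_swap[of "f w" u]
      vec_wedge_swap[of "f w" "f u"]
  consider "j = 0" | "j = Suc 0" | i where "j = Suc (Suc i)" by (metis not0_implies_Suc)
  then show ?thesis
    by cases (simp_all add: bar_wedge_0 bar_wedge_Suc wedge_add_right wedge_twist_right twist_add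
      swap ac_simps)
qed

lemma supported_bar_wedge:
  assumes "endo n f" "vin n u" "\<And>i. supported (dkeys n {d}) (X i)"
  shows "supported (dkeys n {Suc d}) (bar_wedge f u X j)"
proof -
  have "supported (dkeys n {Suc d}) (wedge (vec w) (X i))" if "vin n w" for w i
    by (rule supported_wedge[OF supported_vec[OF that] assms(3)]) simp
  then show ?thesis
    using assms(2) vin_endo[OF assms(1,2)]
    by (cases j) (simp_all add: bar_wedge_0 bar_wedge_Suc supported_add)
qed

text \<open>The coefficients of \<open>D\<^bsub>bar\<^esub>(z)(u\<^sub>1 \<and> \<dots> \<and> u\<^sub>r)\<close>. Unlike \<open>Qbar\<close>, whose signs are trivial in
  degree 1, it is multiplicative.\<close>

definition bar_list :: "('a::comm_semiring_1 vect \<Rightarrow> 'a vect) \<Rightarrow> 'a vect list \<Rightarrow> nat \<Rightarrow> 'a ext" where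
  "bar_list f us = foldr (bar_wedge f) us (\<lambda>j. if j = 0 then gone else 0)"

lemma bar_list_Nil [simp]: "bar_list f [] = (\<lambda>j. if j = 0 then gone else 0)"
  and bar_list_Cons [simp]: "bar_list f (u # us) = bar_wedge f u (bar_list f us)"
  by (simp_all add: bar_list_def)

lemma wedge_list_Nil [simp]: "wedge_list [] = gone"
  and wedge_list_Cons [simp]: "wedge_list (u # us) = wedge (vec u) (wedge_list us)"
  by (simp_all add: wedge_list_def)

lemma supported_gone: "supported (dkeys n {0}) gone"
  unfolding gone_eq_basis_ext by (rule supported_basis_ext) simp

lemma supported_bar_list:
  assumes "endo n f"
  shows "(\<And>u. u \<in> set us \<Longrightarrow> vin n u) \<Longrightarrow> supported (dkeys n {length us}) (bar_list f us j)"
proof (induction us arbitrary: j)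
  case (Cons u us)
  then show ?case using supported_bar_wedge[OF assms, of u "length us"] by simp
qed (simp add: supported_gone)

lemma supported_HS:
  assumes "endo n f"
  shows "(\<And>u. u \<in> set us \<Longrightarrow> vin n u) \<Longrightarrow> supported (dkeys n {length us}) (HS f k us)"
proof (induction us arbitrary: k)
  case (Cons u us)
  have "supported (dkeys n {length (u # us)}) (wedge (vec ((f ^^ i) u)) (HS f (k - i) us))" for i
  proof (rule supported_wedge)
    show "supported (dkeys n {1}) (vec ((f ^^ i) u))"
      using Cons.prems by (intro supported_vec vin_funpow_endo[OF assms]) simp
    show "supported (dkeys n {length us}) (HS f (k - i) us)" using Cons by simp
  qed simp
  then show ?case by (simp add: supported_sum)
qed (simp add: supported_gone)

lemma sum_subsets_card_insert:
  fixes g :: "'b set \<Rightarrow> 'a::comm_monoid_add"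
  assumes "finite A" "a \<notin> A"
  shows "(\<Sum>S | S \<subseteq> insert a A \<and> card S = j. g S) = (\<Sum>S | S \<subseteq> A \<and> card S = j. g S)
    + (case j of 0 \<Rightarrow> 0 | Suc i \<Rightarrow> \<Sum>S | S \<subseteq> A \<and> card S = i. g (insert a S))"
proof -
  have card_insert: "card (insert a S) = Suc (card S)" if "S \<subseteq> A" for S
    using that assms by (meson card_insert_disjoint finite_subset subsetD)
  have "(\<Sum>S | S \<subseteq> insert a A \<and> card S = j. g S)
    = (\<Sum>S | S \<subseteq> A \<and> card S = j. g S) + (\<Sum>S\<in>insert a ` {S. S \<subseteq> A \<and> Suc (card S) = j}. g S)"
  proof (subst sum.union_disjoint[symmetric])
    have "{S. S \<subseteq> insert a A \<and> card S = j}
      = {S \<in> Pow A. card S = j} \<union> {S \<in> insert a ` Pow A. card S = j}"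
      using Pow_insert[of a A] by blast
    also have "\<dots> = {S. S \<subseteq> A \<and> card S = j} \<union> insert a ` {S. S \<subseteq> A \<and> Suc (card S) = j}"
      using card_insert by auto
    finally show "(\<Sum>S | S \<subseteq> insert a A \<and> card S = j. g S)
      = sum g ({S. S \<subseteq> A \<and> card S = j} \<union> insert a ` {S. S \<subseteq> A \<and> Suc (card S) = j})" by simp
  qed (use assms in auto)
  also have "(\<Sum>S\<in>insert a ` {S. S \<subseteq> A \<and> Suc (card S) = j}. g S)
    = (\<Sum>S | S \<subseteq> A \<and> Suc (card S) = j. g (insert a S))"
    using assms(2) by (subst sum.reindex) (auto simp: inj_on_def)
  finally show ?thesis by (cases j) auto
qed

lemma sum_wedge_list_override_on:
  "distinct xs \<Longrightarrow> (\<Sum>S | S \<subseteq> set xs \<and> card S = j. wedge_list (map (override_on g (f \<circ> g) S) xs))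
    = twist (odd j) (bar_list f (map g xs) j)"
proof (induction xs arbitrary: j)
  case Nil
  have subsets_empty: "{S :: 'a set. S \<subseteq> {} \<and> card S = j} = (if j = 0 then {{}} else {})" by auto
  show ?case unfolding list.set subsets_empty by (simp del: sum_constant)
next
  case (Cons x xs)
  define W where "W S = wedge_list (map (override_on g (f \<circ> g) S) xs)" for S
  have insert: "wedge_list (map (override_on g (f \<circ> g) (insert x S)) (x # xs))
      = wedge (vec (f (g x))) (W S)" for S
    using Cons.prems by (simp add: W_def override_on_insert)
  have no_insert: "(\<Sum>S | S \<subseteq> set xs \<and> card S = j.
      wedge_list (map (override_on g (f \<circ> g) S) (x # xs)))
    = (\<Sum>S | S \<subseteq> set xs \<and> card S = j. wedge (vec (g x)) (W S))"
    using Cons.prems by (intro sum.cong refl) (auto simp: W_def override_on_def)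
  have sum_W: "(\<Sum>S | S \<subseteq> set xs \<and> card S = i. W S) = twist (odd i) (bar_list f (map g xs) i)" for i
    unfolding W_def using Cons.prems by (intro Cons.IH) simp
  have "(\<Sum>S | S \<subseteq> set (x # xs) \<and> card S = j. wedge_list (map (override_on g (f \<circ> g) S) (x # xs)))
    = (\<Sum>S | S \<subseteq> set xs \<and> card S = j. wedge (vec (g x)) (W S))
      + (case j of 0 \<Rightarrow> 0 | Suc i \<Rightarrow> \<Sum>S | S \<subseteq> set xs \<and> card S = i. wedge (vec (f (g x))) (W S))"
    using Cons.prems unfolding list.set no_insert[symmetric] insert[symmetric]
    by (intro sum_subsets_card_insert) simp_all
  also have "\<dots> = twist (odd j) (bar_wedge f (g x) (bar_list f (map g xs)) j)"
    unfolding wedge_sum_right[symmetric] sum_W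
    by (cases j) (simp_all add: bar_wedge_0 bar_wedge_Suc wedge_twist_right twist_add)
  finally show ?case unfolding list.map bar_list_Cons .
qed

lemma Qbar_eq_bar_list:
  assumes "endo n f" "\<And>u. u \<in> set us \<Longrightarrow> vin n u" "2 \<le> length us"
  shows "Qbar f j us = bar_list f us j"
proof -
  have "Qbar f j us = (neg ^^ j) (twist (odd j) (bar_list f us j))"
    unfolding Qbar_def using sum_wedge_list_override_on[of "[0..<length us]" "(!) us" f j]
    by (simp add: map_nth lessThan_atLeast0 override_on_def[abs_def] comp_def)
  also have "\<dots> = bar_list f us j"
    using supported_dkeys_mono[OF supported_bar_list[OF assms(1,2)], of us "{2..}" j] assms(3)
    by (subst funpow_neg_eq_twist) auto
  finally show ?thesis .
qed

lemma bar_list_insort: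
  "bar_list f (map g (insort i xs)) j
      = twist (odd (length (filter (\<lambda>x. x < i) xs))) (bar_list f (map g (i # xs)) j)"
  if "sorted xs" for g :: "'b::linorder \<Rightarrow> 'a::comm_semiring_1 vect"
  using that
proof (induction xs arbitrary: j)
  case (Cons x xs)
  show ?case
  proof (cases "i \<le> x")
    case True
    then have "filter (\<lambda>y. y < i) (x # xs) = []" using Cons.prems by (auto simp: filter_empty_conv)
    then show ?thesis using True by simp
  next
    case False
    let ?p = "odd (length (filter (\<lambda>y. y < i) xs))"
    have "bar_list f (map g (insort i xs)) = (\<lambda>l. twist ?p (bar_list f (map g (i # xs)) l))"
      using Cons by (intro ext) simp
    then have "bar_list f (map g (insort i (x # xs))) j
        = bar_wedge f (g x) (\<lambda>l. twist ?p (bar_list f (map g (i # xs)) l)) j"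
      using False by simp
    also have "\<dots> = twist ?p (twist True (bar_list f (map g (i # x # xs)) j))"
      by (simp add: bar_wedge_twist bar_wedge_swap[of f "g x" "g i"])
    finally show ?thesis using False not_le[of i x] by simp
  qed
qed simp

lemma twist_bar_list_repeated:
  "u \<in> set us \<Longrightarrow> twist True (bar_list f (u # us) j) = bar_list f (u # us) j"
proof (induction us arbitrary: j)
  case (Cons w us)
  show ?case
  proof (cases "u = w")
    case True
    then show ?thesis using bar_wedge_swap[of f u u "bar_list f us" j] by simp
  next
    case False
    then have inner: "twist True (bar_list f (u # us) l) = bar_list f (u # us) l" for l
      using Cons by auto
    have "bar_list f (u # w # us) j
      = twist True (bar_wedge f w (\<lambda>l. twist True (bar_list f (u # us) l)) j)"
      unfolding inner by (simp add: bar_wedge_swap[of f u w])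
    also have "\<dots> = bar_wedge f w (bar_list f (u # us)) j" by (simp add: bar_wedge_twist)
    also have "\<dots> = twist True (bar_list f (u # w # us) j)" by (simp add: bar_wedge_swap[of f w u])
    finally show ?thesis by simp
  qed
qed simp

lemma bar_list_basis_list_insert:
  assumes "finite J" "i \<notin> J"
  shows "bar_list f (basis_list (insert i J)) j
      = twist (odd (ninv {i} J)) (bar_list f (bv i # basis_list J) j)"
proof -
  have "length (filter (\<lambda>x. x < i) (sorted_list_of_set J)) = card {x \<in> J. x < i}"
    using distinct_card[of "filter (\<lambda>x. x < i) (sorted_list_of_set J)"] assms(1) by simp
  then show ?thesis
    using bar_list_insort[of "sorted_list_of_set J" f bv i j] assms
    by (simp add: basis_list_def ninv_singleton)
qed

lemma wedge_list_basis_list: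
  assumes "finite I"
  shows "wedge_list (basis_list I) = (basis_ext (I, False) :: 'a::comm_semiring_1 ext)"
proof -
  have "wedge_list (map bv xs) = (basis_ext (set xs, False) :: 'a ext)" if "sorted xs" "distinct xs"
      for xs
    using that
  proof (induction xs)
    case (Cons i xs)
    have "{j \<in> set xs. j < i} = {}" using Cons.prems by auto
    then have "ninv {i} (set xs) = 0" by (simp add: ninv_singleton)
    then show ?case using Cons by (simp add: vec_bv basis_ext_wedge_basis_ext)
  qed (simp add: gone_eq_basis_ext)
  then show ?thesis using assms by (simp add: basis_list_def)
qed

subsection \<open>Signed linear extensions\<close>

definition signed_lin :: "nat \<Rightarrow> (nat set \<Rightarrow> 'a::comm_semiring_1 ext) \<Rightarrow> 'a ext \<Rightarrow> 'a ext" where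
  "signed_lin n g x = (\<Sum>K\<in>dkeys n UNIV. smult (x K) (twist (snd K) (g (fst K))))"

lemma signed_lin_zero [simp]: "signed_lin n g 0 = 0"
  by (simp add: signed_lin_def zero_fun_apply)

lemma signed_lin_add: "signed_lin n g (x + y) = signed_lin n g x + signed_lin n g y"
  by (simp only: signed_lin_def plus_fun_apply smult_add_left sum.distrib)

lemma signed_lin_smult: "signed_lin n g (smult c x) = smult c (signed_lin n g x)"
  by (simp only: signed_lin_def smult_sum smult_smult smult_apply)

lemma signed_lin_sum: "signed_lin n g (\<Sum>i\<in>A. x i) = (\<Sum>i\<in>A. signed_lin n g (x i))"
  using sum_comp_morphism[of "signed_lin n g" x A]
  by (simp only: signed_lin_add signed_lin_zero comp_def)

lemma signed_lin_basis_ext: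
  assumes "I \<subseteq> {..<n}"
  shows "signed_lin n g (basis_ext (I, p)) = twist p (g I)"
proof -
  have "signed_lin n g (basis_ext (I, p))
    = (\<Sum>K\<in>dkeys n UNIV. if K = (I, p) then twist (snd K) (g (fst K)) else 0)"
    unfolding signed_lin_def by (intro sum.cong refl) (auto simp: basis_ext_def)
  then show ?thesis using assms by simp
qed

lemma supported_signed_lin:
  assumes "\<And>I. I \<subseteq> {..<n} \<Longrightarrow> supported (dkeys n {card I}) (g I)" "supported (dkeys n D) x"
  shows "supported (dkeys n D) (signed_lin n g x)"
  using assms(2)
proof (induction rule: ext_induct)
  case (smult_basis c K)
  then show ?case
    using supported_dkeys_mono[OF assms(1)[of "fst K"], of D]
    by (cases K) (simp add: signed_lin_smult signed_lin_basis_ext supported_smult)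
qed (simp_all add: signed_lin_add supported_add)

lemma sum_smult_eq_signed_lin:
  assumes "supported A x" "A \<subseteq> dkeys n UNIV" "\<And>K. K \<in> A \<Longrightarrow> h K = twist (snd K) (g (fst K))"
  shows "(\<Sum>K\<in>A. smult (x K) (h K)) = signed_lin n g x"
  unfolding signed_lin_def using assms
  by (intro sum.mono_neutral_cong_left) (auto simp: supported_def)

definition signed_Dk :: "nat \<Rightarrow> ('a::comm_semiring_1 vect \<Rightarrow> 'a vect) \<Rightarrow> nat \<Rightarrow> 'a ext \<Rightarrow> 'a ext" where
  "signed_Dk n f k = signed_lin n (\<lambda>I. HS f k (basis_list I))"

definition signed_Dbar :: "nat \<Rightarrow> ('a::comm_semiring_1 vect \<Rightarrow> 'a vect) \<Rightarrow> nat \<Rightarrow> 'a ext \<Rightarrow> 'a ext" where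
  "signed_Dbar n f j = signed_lin n (\<lambda>I. bar_list f (basis_list I) j)"

lemma signed_Dk_zero [simp]: "signed_Dk n f k 0 = 0"
  and signed_Dk_add: "signed_Dk n f k (x + y) = signed_Dk n f k x + signed_Dk n f k y"
  and signed_Dk_smult: "signed_Dk n f k (smult c x) = smult c (signed_Dk n f k x)"
  by (simp_all only: signed_Dk_def signed_lin_zero signed_lin_add signed_lin_smult)

lemma signed_Dbar_zero [simp]: "signed_Dbar n f j 0 = 0"
  and signed_Dbar_add: "signed_Dbar n f j (x + y) = signed_Dbar n f j x + signed_Dbar n f j y"
  and signed_Dbar_smult: "signed_Dbar n f j (smult c x) = smult c (signed_Dbar n f j x)"
  and signed_Dbar_sum: "signed_Dbar n f j (\<Sum>i\<in>A. g i) = (\<Sum>i\<in>A. signed_Dbar n f j (g i))"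
  by (simp_all only: signed_Dbar_def signed_lin_zero signed_lin_add signed_lin_smult signed_lin_sum)

lemma signed_Dk_basis_ext:
  "I \<subseteq> {..<n} \<Longrightarrow> signed_Dk n f k (basis_ext (I, p)) = twist p (HS f k (basis_list I))"
  by (simp add: signed_Dk_def signed_lin_basis_ext)

lemma signed_Dbar_basis_ext:
  "I \<subseteq> {..<n} \<Longrightarrow> signed_Dbar n f j (basis_ext (I, p)) = twist p (bar_list f (basis_list I) j)"
  by (simp add: signed_Dbar_def signed_lin_basis_ext)

lemma supported_HS_basis_list:
  assumes "endo n f" "I \<subseteq> {..<n}"
  shows "supported (dkeys n {card I}) (HS f k (basis_list I))"
  using supported_HS[OF assms(1) vin_basis_list[OF assms(2)], where us = "basis_list I"] by simp

lemma supported_bar_list_basis_list: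
  assumes "endo n f" "I \<subseteq> {..<n}"
  shows "supported (dkeys n {card I}) (bar_list f (basis_list I) j)"
  using supported_bar_list[OF assms(1) vin_basis_list[OF assms(2)], where us = "basis_list I"]
  by simp

lemma supported_signed_Dk:
  "endo n f \<Longrightarrow> supported (dkeys n D) x \<Longrightarrow> supported (dkeys n D) (signed_Dk n f k x)"
  unfolding signed_Dk_def by (intro supported_signed_lin supported_HS_basis_list)

lemma supported_signed_Dbar:
  "endo n f \<Longrightarrow> supported (dkeys n D) x \<Longrightarrow> supported (dkeys n D) (signed_Dbar n f j x)"
  unfolding signed_Dbar_def by (intro supported_signed_lin supported_bar_list_basis_list)

lemma Dk_eq_signed_Dk:
  assumes "endo n f" "gwf n x"
  shows "Dk n f k x = signed_Dk n f k x"
  unfolding Dk_def signed_Dk_def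
proof (rule sum_smult_eq_signed_lin)
  show "supported (gkeys n) x" using assms(2) by (simp add: gwf_def supported_def)
  show "gkeys n \<subseteq> dkeys n UNIV" by (auto simp: gkeys_def)
  fix K assume "K \<in> gkeys n"
  then have "fst K \<subseteq> {..<n}" "snd K \<Longrightarrow> {card (fst K)} \<subseteq> {2..}" by (auto simp: gkeys_def)
  then show "negp (snd K) (HS f k (basis_list (fst K)))
      = twist (snd K) (HS f k (basis_list (fst K)))"
    by (rule negp_eq_twist[OF supported_HS_basis_list[OF assms(1)]])
qed

lemma Dbar_eq_signed_Dbar:
  assumes "endo n f" "supported (dkeys n {2..}) x"
  shows "Dbar n f j x = signed_Dbar n f j x"
proof -
  have "{K \<in> gkeys n. 2 \<le> card (fst K)} = dkeys n {2..}" by (auto simp: gkeys_def)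
  moreover have "(\<Sum>K\<in>dkeys n {2..}. smult (x K) (negp (snd K) (Qbar f j (basis_list (fst K)))))
      = signed_Dbar n f j x"
    unfolding signed_Dbar_def
  proof (rule sum_smult_eq_signed_lin[OF assms(2)])
    fix K assume "K \<in> dkeys n {2..}"
    then have K: "fst K \<subseteq> {..<n}" "{card (fst K)} \<subseteq> {2..}" by (auto simp: dkeys_def)
    have "Qbar f j (basis_list (fst K)) = bar_list f (basis_list (fst K)) j"
      using K(2) by (intro Qbar_eq_bar_list[OF assms(1) vin_basis_list[OF K(1)]]) auto
    then show "negp (snd K) (Qbar f j (basis_list (fst K)))
        = twist (snd K) (bar_list f (basis_list (fst K)) j)"
      using negp_eq_twist[OF supported_bar_list_basis_list[OF assms(1) K(1)] K(2)] by simp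
  qed auto
  ultimately show ?thesis by (simp add: Dbar_def)
qed

lemma signed_Dbar_vec:
  assumes "endo n f" "vin n w"
  shows "signed_Dbar n f j (vec w)
    = (if j = 0 then vec w else if j = 1 then twist True (vec (f w)) else 0)"
proof -
  have "signed_Dbar n f j (vec w) = bar_wedge f w (bar_list f []) j"
    using assms(2)
  proof (induction rule: vin_induct)
    case zero
    show ?case by (simp add: bar_wedge_zero_left endo_zero[OF assms(1)])
  next
    case (add v w)
    then show ?case
      by (simp add: signed_Dbar_add vec_add bar_wedge_add_left endo_add[OF assms(1)])
  next
    case (smult_bv c i)
    have "signed_Dbar n f j (vec (bv i)) = bar_wedge f (bv i) (bar_list f []) j"
      using smult_bv by (simp add: vec_bv signed_Dbar_basis_ext basis_list_def)
    then show ?case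
      using smult_bv by (simp add: vec_smult signed_Dbar_smult bar_wedge_smult_left
        endo_smult[OF assms(1)] vin_bv)
  qed
  moreover have "wedge (vec v) gone = vec v" if "vin n v" for v :: "'a vect"
    by (rule wedge_gone_right[OF supported_vec[OF that]])
  ultimately show ?thesis
    using assms vin_endo[OF assms] by (cases j) (auto simp: bar_wedge_0 bar_wedge_Suc)
qed

subsection \<open>The classical identity\<close>

text \<open>In a cancellative semiring, \<open>same_diff\<close> is equality after passing to the classical
  exterior algebra over the ring of differences.\<close>

definition same_diff :: "'a::comm_semiring_1 ext \<Rightarrow> 'a ext \<Rightarrow> bool" where
  "same_diff x y \<longleftrightarrow> x + twist True y = y + twist True x"

lemma same_diff_refl [simp]: "same_diff x x"
  by (simp add: same_diff_def)

lemma same_diff_trans [trans]: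
  fixes x y z :: "'a::{comm_semiring_1,cancel_semigroup_add} ext"
  assumes "same_diff x y" "same_diff y z"
  shows "same_diff x z"
proof -
  have "(x + twist True z) + (y + twist True y) = (x + twist True y) + (y + twist True z)"
    by (simp only: ac_simps)
  also have "\<dots> = (y + twist True x) + (z + twist True y)" using assms by (simp only: same_diff_def)
  also have "\<dots> = (z + twist True x) + (y + twist True y)" by (simp only: ac_simps)
  finally show ?thesis unfolding same_diff_def by (simp only: add_right_cancel)
qed

lemma same_diff_add:
  assumes "same_diff x y" "same_diff x' y'"
  shows "same_diff (x + x') (y + y')"
proof -
  have "(x + x') + (twist True y + twist True y') = (x + twist True y) + (x' + twist True y')"
    by (simp only: ac_simps)
  also have "\<dots> = (y + twist True x) + (y' + twist True x')"
    using assms by (simp only: same_diff_def)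
  also have "\<dots> = (y + y') + (twist True x + twist True x')" by (simp only: ac_simps)
  finally show ?thesis unfolding same_diff_def twist_add .
qed

lemma same_diff_sum: "(\<And>i. i \<in> A \<Longrightarrow> same_diff (g i) (h i)) \<Longrightarrow> same_diff (\<Sum>i\<in>A. g i) (\<Sum>i\<in>A. h i)"
  by (induction A rule: infinite_finite_induct) (simp_all add: same_diff_add)

lemma same_diff_smult: "same_diff x y \<Longrightarrow> same_diff (smult c x) (smult c y)"
  unfolding same_diff_def twist_smult smult_add_right[symmetric] by simp

lemma same_diff_twist: "same_diff x y \<Longrightarrow> same_diff (twist p x) (twist p y)"
  by (cases p) (simp_all add: same_diff_def add.commute)

lemma same_diff_wedge_right: "same_diff x y \<Longrightarrow> same_diff (wedge w x) (wedge w y)"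
  unfolding same_diff_def wedge_twist_right[symmetric] wedge_add_right[symmetric] by simp

lemma signed_Dbar_bv_wedge_basis_ext:
  assumes "i < n" "J \<subseteq> {..<n}"
  shows "same_diff (signed_Dbar n f j (wedge (vec (bv i)) (basis_ext (J, p))))
    (bar_wedge f (bv i) (\<lambda>l. signed_Dbar n f l (basis_ext (J, p))) j)"
proof -
  have "finite J" using assms(2) finite_subset by blast
  then have wedge: "wedge (vec (bv i)) (basis_ext (J, p))
    = (if i \<in> J then 0 else basis_ext (insert i J, p \<noteq> odd (ninv {i} J)) :: 'a ext)"
    by (simp add: vec_bv basis_ext_wedge_basis_ext)
  have bar: "bar_wedge f (bv i) (\<lambda>l. signed_Dbar n f l (basis_ext (J, p))) j
    = twist p (bar_list f (bv i # basis_list J) j)"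
    using assms(2) by (simp add: signed_Dbar_basis_ext bar_wedge_twist)
  show ?thesis
  proof (cases "i \<in> J")
    case True
    then have "bv i \<in> set (basis_list J :: 'a vect list)"
      using \<open>finite J\<close> by (simp add: basis_list_def)
    then have "same_diff 0 (bar_list f (bv i # basis_list J) j)"
      by (simp only: same_diff_def twist_bar_list_repeated twist_zero add_0_left add_0_right)
    from same_diff_twist[OF this, of p] show ?thesis
      unfolding wedge bar using True by simp
  next
    case False
    have "signed_Dbar n f j (basis_ext (insert i J, q))
        = twist q (bar_list f (basis_list (insert i J)) j)" for q
      using assms by (simp add: signed_Dbar_basis_ext)
    also have "twist (p \<noteq> odd (ninv {i} J)) (bar_list f (basis_list (insert i J)) j)
      = twist p (bar_list f (bv i # basis_list J) j)"
      unfolding bar_list_basis_list_insert[OF \<open>finite J\<close> False] twist_twist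
      by (rule arg_cong[where f = "\<lambda>q. twist q _"]) blast
    finally show ?thesis
      using False by (simp only: wedge bar if_False same_diff_refl)
  qed
qed

lemma signed_Dbar_vec_wedge:
  assumes f: "endo n f" and w: "vin n w" and x: "supported (dkeys n UNIV) x"
  shows "same_diff (signed_Dbar n f j (wedge (vec w) x))
      (bar_wedge f w (\<lambda>l. signed_Dbar n f l x) j)"
  using w
proof (induction rule: vin_induct)
  case zero
  show ?case by (simp add: bar_wedge_zero_left endo_zero[OF f])
next
  case (add v w)
  then show ?case
    by (simp add: vec_add wedge_add_left signed_Dbar_add bar_wedge_add_left endo_add[OF f]
      same_diff_add)
next
  case (smult_bv c i)
  have "same_diff (signed_Dbar n f j (wedge (vec (bv i)) x))
      (bar_wedge f (bv i) (\<lambda>l. signed_Dbar n f l x) j)"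
    using x
  proof (induction rule: ext_induct)
    case zero
    show ?case by (simp add: bar_wedge_zero)
  next
    case (add x y)
    then show ?case
      by (simp add: wedge_add_right signed_Dbar_add bar_wedge_add same_diff_add)
  next
    case (smult_basis d K)
    then have "same_diff (signed_Dbar n f j (wedge (vec (bv i)) (basis_ext K)))
      (bar_wedge f (bv i) (\<lambda>l. signed_Dbar n f l (basis_ext K)) j)"
      using signed_Dbar_bv_wedge_basis_ext[OF smult_bv] by (cases K) simp
    then show ?case
      by (simp add: wedge_smult_right signed_Dbar_smult bar_wedge_smult same_diff_smult)
  qed
  then show ?case
    using smult_bv
    by (simp add: vec_smult wedge_smult_left signed_Dbar_smult bar_wedge_smult_left
      endo_smult[OF f] vin_bv same_diff_smult)
qed

lemma sum_triangle_swap: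
  fixes g :: "nat \<Rightarrow> nat \<Rightarrow> 'a::comm_monoid_add"
  shows "(\<Sum>j\<le>k. \<Sum>i\<le>k - j. g i j) = (\<Sum>i\<le>k. \<Sum>j\<le>k - i. g i j)"
proof -
  have "{..k - j} = {i \<in> {..k}. i + j \<le> k}" "{..k - j} = {i \<in> {..k}. j + i \<le> k}" if "j \<le> k" for j
    using that by auto
  then show ?thesis
    using sum.swap_restrict[of "{..k}" "{..k}" "\<lambda>j i. g i j" "\<lambda>j i. j + i \<le> k"] by simp
qed

lemma bar_wedge_convolution:
  "(\<Sum>j\<le>k. bar_wedge f u (\<lambda>l. X l (k - j)) j) = bar_wedge f u (\<lambda>m. \<Sum>j\<le>m. X j (m - j)) k"
proof (cases k)
  case (Suc m)
  have "(\<Sum>j\<le>m. bar_wedge f u (\<lambda>l. X l (k - Suc j)) (Suc j))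
    = (\<Sum>j\<le>m. wedge (vec u) (X (Suc j) (k - Suc j)))
      + twist True (wedge (vec (f u)) (\<Sum>j\<le>m. X j (m - j)))"
    by (simp only: Suc bar_wedge_Suc sum.distrib twist_sum wedge_sum_right diff_Suc_Suc)
  then show ?thesis
    unfolding Suc sum.atMost_Suc_shift bar_wedge_0 bar_wedge_Suc wedge_add_right wedge_sum_right
    by (simp only: diff_zero add.assoc)
qed (simp add: bar_wedge_0)

lemma bar_wedge_telescope:
  "same_diff (\<Sum>i\<le>k. bar_wedge f ((f ^^ i) u) X (k - i)) (wedge (vec u) (X k))"
proof (cases k)
  case (Suc m)
  define C where "C = (\<Sum>i\<le>m. wedge (vec ((f ^^ Suc i) u)) (X (m - i)))"
  have "(\<Sum>i\<le>k. bar_wedge f ((f ^^ i) u) X (k - i))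
    = (\<Sum>i\<le>k. wedge (vec ((f ^^ i) u)) (X (k - i))) + twist True C"
    unfolding Suc sum.atMost_Suc C_def twist_sum
    by (simp add: bar_wedge_0 bar_wedge_Suc Suc_diff_le sum.distrib ac_simps)
  also have "(\<Sum>i\<le>k. wedge (vec ((f ^^ i) u)) (X (k - i))) = wedge (vec u) (X k) + C"
    unfolding Suc sum.atMost_Suc_shift C_def by simp
  finally show ?thesis
    by (simp add: same_diff_def twist_add ac_simps)
qed (simp add: bar_wedge_0)

lemma signed_Dbar_HS_wedge:
  fixes f :: "'a::{comm_semiring_1,cancel_semigroup_add} vect \<Rightarrow> 'a vect"
  assumes f: "endo n f" and y: "supported (dkeys n UNIV) y"
  shows "(\<And>u. u \<in> set us \<Longrightarrow> vin n u) \<Longrightarrow>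
    same_diff (\<Sum>j\<le>k. signed_Dbar n f j (wedge (HS f (k - j) us) y))
        (wedge (wedge_list us) (signed_Dbar n f k y))"
proof (induction us arbitrary: k)
  case Nil
  have "(\<Sum>j\<le>k. signed_Dbar n f j (wedge (HS f (k - j) []) y))
      = (\<Sum>j\<le>k. if j = k then signed_Dbar n f j y else 0)"
    using wedge_gone_left[OF y] by (intro sum.cong refl) auto
  then show ?case
    using wedge_gone_left[OF supported_signed_Dbar[OF f y]] by simp
next
  case (Cons u us)
  define X where "X m = wedge (HS f m us) y" for m
  define G where "G m = (\<Sum>j\<le>m. signed_Dbar n f j (X (m - j)))" for m
  have X: "supported (dkeys n UNIV) (X m)" for m
    unfolding X_def using Cons.prems by (intro supported_wedge[OF supported_HS[OF f] y]) auto
  have u: "vin n ((f ^^ i) u)" for i using Cons.prems f by (simp add: vin_funpow_endo)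
  have HS_Cons: "wedge (HS f m (u # us)) y = (\<Sum>i\<le>m. wedge (vec ((f ^^ i) u)) (X (m - i)))" for m
    by (simp only: HS.simps wedge_sum_left wedge_assoc X_def)
  have "same_diff (\<Sum>j\<le>k. signed_Dbar n f j (wedge (HS f (k - j) (u # us)) y))
    (\<Sum>j\<le>k. \<Sum>i\<le>k - j. bar_wedge f ((f ^^ i) u) (\<lambda>l. signed_Dbar n f l (X (k - j - i))) j)"
    unfolding HS_Cons signed_Dbar_sum by (intro same_diff_sum signed_Dbar_vec_wedge[OF f u X])
  also have "(\<Sum>j\<le>k. \<Sum>i\<le>k - j. bar_wedge f ((f ^^ i) u) (\<lambda>l. signed_Dbar n f l (X (k - j - i))) j)
    = (\<Sum>i\<le>k. bar_wedge f ((f ^^ i) u) G (k - i))"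
    unfolding G_def bar_wedge_convolution[where X = "\<lambda>l m. signed_Dbar n f l (X m)", symmetric]
    by (subst sum_triangle_swap) (simp only: diff_commute)
  also have "same_diff \<dots> (wedge (vec u) (G k))"
    by (rule bar_wedge_telescope)
  also have "same_diff \<dots> (wedge (vec u) (wedge (wedge_list us) (signed_Dbar n f k y)))"
    unfolding G_def X_def using Cons by (intro same_diff_wedge_right Cons.IH) simp
  finally show ?case by (simp add: wedge_assoc)
qed

definition signed_lhs ::
  "nat \<Rightarrow> ('a::comm_semiring_1 vect \<Rightarrow> 'a vect) \<Rightarrow> 'a ext \<Rightarrow> 'a ext \<Rightarrow> nat \<Rightarrow> 'a ext" where
  "signed_lhs n f u v k = (\<Sum>j\<le>k. signed_Dbar n f j (wedge (signed_Dk n f (k - j) u) v))"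

definition signed_rhs ::
  "nat \<Rightarrow> ('a::comm_semiring_1 vect \<Rightarrow> 'a vect) \<Rightarrow> 'a ext \<Rightarrow> 'a ext \<Rightarrow> nat \<Rightarrow> 'a ext" where
  "signed_rhs n f u v k = wedge u (signed_Dbar n f k v)"

lemma signed_Dbar_twist: "signed_Dbar n f j (twist p x) = twist p (signed_Dbar n f j x)"
  if "supported (dkeys n UNIV) x"
  using that
proof (induction rule: ext_induct)
  case (smult_basis c K)
  then show ?case
    by (cases K) (simp add: twist_smult signed_Dbar_smult twist_basis_ext signed_Dbar_basis_ext)
qed (simp_all add: twist_add signed_Dbar_add)

lemma same_diff_signed_lhs_rhs_basis:
  fixes f :: "'a::{comm_semiring_1,cancel_semigroup_add} vect \<Rightarrow> 'a vect"
  assumes f: "endo n f" and I: "I \<subseteq> {..<n}" and v: "supported (dkeys n UNIV) v"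
  shows "same_diff (signed_lhs n f (basis_ext (I, p)) v k) (signed_rhs n f (basis_ext (I, p)) v k)"
proof -
  have "supported (dkeys n UNIV) (wedge (HS f m (basis_list I)) v)" for m
    by (rule supported_wedge[OF supported_HS_basis_list[OF f I] v]) simp
  then have "signed_lhs n f (basis_ext (I, p)) v k
    = twist p (\<Sum>j\<le>k. signed_Dbar n f j (wedge (HS f (k - j) (basis_list I)) v))"
    using I
    by (simp add: signed_lhs_def signed_Dk_basis_ext wedge_twist_left
      signed_Dbar_twist twist_sum)
  moreover have "signed_rhs n f (basis_ext (I, p)) v k
      = twist p (wedge (wedge_list (basis_list I)) (signed_Dbar n f k v))"
    using finite_subset[OF I]
    by (simp add: signed_rhs_def wedge_list_basis_list twist_basis_ext flip: wedge_twist_left)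
  ultimately show ?thesis
    using same_diff_twist[OF signed_Dbar_HS_wedge[OF f v vin_basis_list[OF I]]] by simp
qed

subsection \<open>The generic matrix\<close>

text \<open>A monomial in the entries of the generic matrix is the multiset of the positions
  (row, column) of its factors.\<close>

type_synonym gpoly = "(nat \<times> nat) multiset \<Rightarrow>\<^sub>0 nat"

definition entry_var :: "nat \<Rightarrow> nat \<Rightarrow> gpoly" where
  "entry_var l j = Poly_Mapping.single {#(l, j)#} 1"

definition generic_endo :: "nat \<Rightarrow> gpoly vect \<Rightarrow> gpoly vect" where
  "generic_endo n v = (\<lambda>l. if l < n then \<Sum>j<n. v j * entry_var l j else 0)"

lemma endo_generic_endo: "endo n (generic_endo n)"
  by (auto simp: endo_def vin_def generic_endo_def fun_eq_iff plus_fun_apply sum.distrib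
    algebra_simps sum_distrib_left)

lemma generic_endo_bv:
  assumes "j < n"
  shows "generic_endo n (bv j) = (\<lambda>l. if l < n then entry_var l j else 0)"
proof
  fix l
  have "(\<Sum>i<n. bv j i * entry_var l i) = (\<Sum>i<n. if i = j then entry_var l i else 0)"
    by (intro sum.cong) (auto simp: bv_def)
  then show "generic_endo n (bv j) l = (if l < n then entry_var l j else 0)"
    using assms by (simp add: generic_endo_def)
qed

lemma vec_generic_endo_bv:
  assumes "j < n"
  shows "vec (generic_endo n (bv j)) = (\<Sum>l<n. smult (entry_var l j) (basis_ext ({l}, False)))"
proof
  fix K :: "nat set \<times> bool"
  have "(\<Sum>l<n. smult (entry_var l j) (basis_ext ({l}, False))) K
      = (\<Sum>l<n. if K = ({l}, False) then entry_var l j else 0)"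
    unfolding sum_fun_apply by (intro sum.cong refl) (simp add: smult_apply basis_ext_def)
  also have "\<dots> = vec (generic_endo n (bv j)) K"
  proof (cases "\<exists>l. K = ({l}, False)")
    case True
    then show ?thesis by (auto simp: vec_def generic_endo_bv[OF assms])
  next
    case False
    then show ?thesis by (cases K) (auto simp: vec_def card_1_singleton_iff)
  qed
  finally show "vec (generic_endo n (bv j)) K
      = (\<Sum>l<n. smult (entry_var l j) (basis_ext ({l}, False))) K" ..
qed

definition monomials :: "('k \<Rightarrow> 'm \<Rightarrow>\<^sub>0 'c::zero) \<Rightarrow> 'm set" where
  "monomials x = (\<Union>K. Poly_Mapping.keys (x K))"

definition separated :: "('k \<Rightarrow> 'm \<Rightarrow>\<^sub>0 'c::zero) \<Rightarrow> bool" where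
  "separated x \<longleftrightarrow> disjoint_family (\<lambda>K. Poly_Mapping.keys (x K))"

lemma separatedD: "separated x \<Longrightarrow> m \<in> Poly_Mapping.keys (x K) \<Longrightarrow> m \<in> Poly_Mapping.keys (x L) \<Longrightarrow> K = L"
  unfolding separated_def disjoint_family_on_def by blast

lemma separatedI:
  "(\<And>m K L. m \<in> Poly_Mapping.keys (x K) \<Longrightarrow> m \<in> Poly_Mapping.keys (x L) \<Longrightarrow> K = L) \<Longrightarrow> separated x"
  unfolding separated_def disjoint_family_on_def by blast

lemma monomials_zero [simp]: "monomials 0 = {}"
  by (simp add: monomials_def zero_fun_apply)

lemma separated_zero [simp]: "separated 0"
  by (rule separatedI) (simp add: zero_fun_apply)

lemma monomials_add: "monomials (x + y) \<subseteq> monomials x \<union> monomials y"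
  for x y :: "'k \<Rightarrow> 'm \<Rightarrow>\<^sub>0 'c::monoid_add"
  using Poly_Mapping.keys_add[of "x K" "y K" for K]
  by (fastforce simp: monomials_def plus_fun_apply)

lemma separated_add:
  fixes x y :: "'k \<Rightarrow> 'm \<Rightarrow>\<^sub>0 'c::monoid_add"
  assumes "separated x" "separated y" "monomials x \<inter> monomials y = {}"
  shows "separated (x + y)"
proof (rule separatedI)
  fix m K L assume "m \<in> Poly_Mapping.keys ((x + y) K)" "m \<in> Poly_Mapping.keys ((x + y) L)"
  then have "m \<in> Poly_Mapping.keys (x K) \<union> Poly_Mapping.keys (y K)"
    "m \<in> Poly_Mapping.keys (x L) \<union> Poly_Mapping.keys (y L)"
    using Poly_Mapping.keys_add[of "x _" "y _"] by (auto simp: plus_fun_apply)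
  then show "K = L"
    using separatedD[OF assms(1), of m K L] separatedD[OF assms(2), of m K L] assms(3)
    by (auto simp: monomials_def)
qed

lemma monomials_sum: "monomials (\<Sum>i\<in>A. g i) \<subseteq> (\<Union>i\<in>A. monomials (g i))"
  for g :: "'i \<Rightarrow> 'k \<Rightarrow> 'm \<Rightarrow>\<^sub>0 'c::comm_monoid_add"
proof (induction A rule: infinite_finite_induct)
  case (insert i A)
  then show ?case using monomials_add[of "g i" "sum g A"] by auto
qed simp_all

lemma separated_sum:
  fixes g :: "'i \<Rightarrow> 'k \<Rightarrow> 'm \<Rightarrow>\<^sub>0 'c::comm_monoid_add"
  assumes "\<And>i. i \<in> A \<Longrightarrow> separated (g i)" "disjoint_family_on (\<lambda>i. monomials (g i)) A"
  shows "separated (\<Sum>i\<in>A. g i)"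
  using assms
proof (induction A rule: infinite_finite_induct)
  case (insert i A)
  have "monomials (g i) \<inter> monomials (\<Sum>i\<in>A. g i) = {}"
    using insert.prems(2) monomials_sum[of g A]
      disjoint_family_on_insert[OF insert.hyps(2), of "\<lambda>i. monomials (g i)"]
    by blast
  moreover have "disjoint_family_on (\<lambda>i. monomials (g i)) A"
    using insert.prems(2) by (rule disjoint_family_on_mono[rotated]) blast
  ultimately show ?case using insert by (simp add: separated_add)
qed simp_all

lemma monomials_twist: "monomials (twist p x) = monomials x"
  by (cases p) (simp_all add: monomials_def set_eq_iff split_paired_Ex ex_bool_eq disj_commute)

lemma separated_twist: "separated x \<Longrightarrow> separated (twist p x)"
  by (intro separatedI) (auto dest: separatedD)

lemma monomials_basis_ext_wedge: "monomials (wedge (basis_ext K) x) \<subseteq> monomials x"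
  by (cases K) (auto simp: monomials_def basis_ext_wedge_apply split: if_splits)

lemma separated_basis_ext_wedge:
  assumes "separated x"
  shows "separated (wedge (basis_ext (I, p)) x)"
proof (rule separatedI)
  fix m K L
  assume "m \<in> Poly_Mapping.keys (wedge (basis_ext (I, p)) x K)"
      "m \<in> Poly_Mapping.keys (wedge (basis_ext (I, p)) x L)"
  moreover obtain K' r L' s where "K = (K', r)" "L = (L', s)" by (cases K; cases L)
  ultimately have "I \<subseteq> K'" "I \<subseteq> L'" "K' - I = L' - I"
    and sign: "(p \<noteq> (r \<noteq> odd (ninv I (K' - I)))) = (p \<noteq> (s \<noteq> odd (ninv I (L' - I))))"
    by (auto simp: basis_ext_wedge_apply split: if_splits dest: separatedD[OF assms])
  then have "K' = L'" by blast
  then show "K = L" using sign \<open>K = (K', r)\<close> \<open>L = (L', s)\<close> by auto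
qed

lemma keys_entry_var_mult:
  "Poly_Mapping.keys (entry_var l j * p) \<subseteq> add_mset (l, j) ` Poly_Mapping.keys p"
  using Poly_Mapping.keys_mult[of "entry_var l j" p] by (auto simp: entry_var_def)

lemma monomials_smult_entry_var:
  "monomials (smult (entry_var l j) x) \<subseteq> add_mset (l, j) ` monomials x"
  using keys_entry_var_mult by (fastforce simp: monomials_def smult_apply)

lemma separated_smult_entry_var:
  assumes "separated x"
  shows "separated (smult (entry_var l j) x)"
proof (rule separatedI)
  fix m K L
  assume "m \<in> Poly_Mapping.keys (smult (entry_var l j) x K)"
      "m \<in> Poly_Mapping.keys (smult (entry_var l j) x L)"
  then obtain m' where "m' \<in> Poly_Mapping.keys (x K)" "m' \<in> Poly_Mapping.keys (x L)"
    using keys_entry_var_mult[of l j "x K"] keys_entry_var_mult[of l j "x L"]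
    unfolding smult_apply by fastforce
  then show "K = L" by (rule separatedD[OF assms])
qed

definition column_support :: "(nat \<times> nat) multiset \<Rightarrow> nat set" where
  "column_support m = snd ` set_mset m"

lemma column_support_add_mset [simp]:
  "column_support (add_mset (l, j) m) = insert j (column_support m)"
  by (simp add: column_support_def)

lemma wedge_vec_generic_endo_bv:
  "j < n \<Longrightarrow> wedge (vec (generic_endo n (bv j))) x
      = (\<Sum>l<n. smult (entry_var l j) (wedge (basis_ext ({l}, False)) x))"
  by (simp only: vec_generic_endo_bv wedge_sum_left wedge_smult_left)

lemma monomials_wedge_vec_generic_endo_bv:
  assumes "j < n"
  shows "monomials (wedge (vec (generic_endo n (bv j))) x) \<subseteq> (\<Union>l<n. add_mset (l, j) ` monomials x)"
proof -
  have "monomials (wedge (vec (generic_endo n (bv j))) x)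
      \<subseteq> (\<Union>l<n. monomials (smult (entry_var l j) (wedge (basis_ext ({l}, False)) x)))"
    unfolding wedge_vec_generic_endo_bv[OF assms] by (rule monomials_sum)
  also have "\<dots> \<subseteq> (\<Union>l<n. add_mset (l, j) ` monomials x)"
    by (intro UN_mono order_refl order_trans[OF monomials_smult_entry_var] image_mono
      monomials_basis_ext_wedge)
  finally show ?thesis .
qed

lemma separated_wedge_vec_generic_endo_bv:
  assumes "j < n" "separated x" "\<And>m. m \<in> monomials x \<Longrightarrow> j \<notin> column_support m"
  shows "separated (wedge (vec (generic_endo n (bv j))) x)"
  unfolding wedge_vec_generic_endo_bv[OF assms(1)]
proof (rule separated_sum)
  fix l show "separated (smult (entry_var l j) (wedge (basis_ext ({l}, False)) x))"
    by (intro separated_smult_entry_var separated_basis_ext_wedge assms(2))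
next
  have "add_mset (l, j) ` monomials x \<inter> add_mset (l', j) ` monomials x = {}" if "l \<noteq> l'" for l l'
  proof (rule equals0I, elim IntE imageE)
    fix t m m' assume m: "t = add_mset (l, j) m" "m \<in> monomials x" and "t = add_mset (l', j) m'"
    then have "(l', j) \<in># m" using that by (metis insert_noteq_member prod.inject)
    then have "snd (l', j) \<in> column_support m" unfolding column_support_def by (rule imageI)
    then show False using assms(3)[OF m(2)] by simp
  qed
  then have "disjoint_family (\<lambda>l. add_mset (l, j) ` monomials x)"
    by (simp add: disjoint_family_on_def)
  then have "disjoint_family
    (\<lambda>l. monomials (smult (entry_var l j) (wedge (basis_ext ({l}, False)) x)))"
    by (rule disjoint_family_subset)
      (intro order_trans[OF monomials_smult_entry_var] image_mono monomials_basis_ext_wedge)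
  then show "disjoint_family_on
    (\<lambda>l. monomials (smult (entry_var l j) (wedge (basis_ext ({l}, False)) x))) {..<n}"
    by (rule disjoint_family_on_mono[rotated]) simp
qed

lemma column_support_bar_list:
  "set js \<subseteq> {..<n} \<Longrightarrow> m \<in> monomials (bar_list (generic_endo n) (map bv js) k)
    \<Longrightarrow> column_support m \<subseteq> set js"
proof (induction js arbitrary: m k)
  case Nil
  then show ?case
    by (auto simp: monomials_def gone_def column_support_def zero_fun_apply split: if_splits)
next
  case (Cons j js)
  let ?X = "bar_list (generic_endo n) (map bv js)" and ?c = "vec (generic_endo n (bv j))"
  have IH: "column_support m' \<subseteq> set js" if "m' \<in> monomials (?X i)" for m' i
    using Cons that by auto
  have monomials_bv: "monomials (wedge (vec (bv j)) (?X i)) \<subseteq> monomials (?X i)" for i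
    unfolding vec_bv by (rule monomials_basis_ext_wedge)
  have monomials_generic: "monomials (wedge ?c (?X i)) \<subseteq> (\<Union>l<n. add_mset (l, j) ` monomials (?X i))"
      for i
    using Cons.prems by (intro monomials_wedge_vec_generic_endo_bv) simp
  consider i where "m \<in> monomials (?X i)"
    | i l m' where "m = add_mset (l, j) m'" "m' \<in> monomials (?X i)"
  proof (cases k)
    case 0
    then show thesis
      using Cons.prems(2) monomials_bv[of 0] that(1)[of 0] by (auto simp: bar_wedge_0)
  next
    case (Suc i)
    then have "m \<in> monomials (wedge (vec (bv j)) (?X k)) \<union> monomials (wedge ?c (?X i))"
      using Cons.prems(2)
        monomials_add[of "wedge (vec (bv j)) (?X k)" "twist True (wedge ?c (?X i))"]
      unfolding monomials_twist by (auto simp: bar_wedge_Suc)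
    then show thesis using monomials_bv[of k] monomials_generic[of i] that by blast
  qed
  then show ?case using IH by cases auto
qed

text \<open>The column \<open>j\<close> occurs in a monomial of the second summand of \<open>bar_wedge\<close>, and in exactly
  one entry, but in no monomial of the first.\<close>

lemma separated_bar_list:
  "distinct js \<Longrightarrow> set js \<subseteq> {..<n} \<Longrightarrow> separated (bar_list (generic_endo n) (map bv js) k)"
proof (induction js arbitrary: k)
  case Nil
  show ?case by (rule separatedI) (auto simp: gone_def zero_fun_apply split: if_splits)
next
  case (Cons j js)
  let ?X = "bar_list (generic_endo n) (map bv js)" and ?c = "vec (generic_endo n (bv j))"
  have j: "j < n" and X: "separated (?X i)" for i using Cons by auto
  have no_j: "j \<notin> column_support m" if "m \<in> monomials (?X i)" for m i
    using column_support_bar_list[of js n m i] that Cons.prems by auto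
  have bv: "separated (wedge (vec (bv j)) (?X i))" for i
    unfolding vec_bv by (intro separated_basis_ext_wedge X)
  show ?case
  proof (cases k)
    case 0
    then show ?thesis using bv by (simp add: bar_wedge_0)
  next
    case (Suc i)
    have "j \<notin> column_support m" if "m \<in> monomials (wedge (vec (bv j)) (?X k))" for m
      using that no_j monomials_basis_ext_wedge unfolding vec_bv by blast
    moreover have "j \<in> column_support m" if "m \<in> monomials (wedge ?c (?X i))" for m
      using that monomials_wedge_vec_generic_endo_bv[OF j, of "?X i"] by auto
    ultimately have "monomials (wedge (vec (bv j)) (?X k)) \<inter> monomials (wedge ?c (?X i)) = {}"
      by blast
    then show ?thesis
      using bv separated_wedge_vec_generic_endo_bv[OF j X no_j] Suc
      by (simp add: bar_wedge_Suc separated_add separated_twist monomials_twist)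
  qed
qed

lemma separated_signed_rhs_basis:
  assumes "J \<subseteq> {..<n}"
  shows "separated (signed_rhs n (generic_endo n) (basis_ext K) (basis_ext (J, q)) k)"
proof -
  have "separated (bar_list (generic_endo n) (basis_list J) k)"
    using assms finite_subset[OF assms] unfolding basis_list_def by (intro separated_bar_list) auto
  then show ?thesis
    by (cases K) (simp add: signed_rhs_def signed_Dbar_basis_ext[OF assms]
        separated_basis_ext_wedge separated_twist)
qed

definition quasi_zero :: "nat \<Rightarrow> 'a::zero ext \<Rightarrow> bool" where
  "quasi_zero n d \<longleftrightarrow> twist True d = d \<and> supported (dkeys n {2..}) d"

definition surpasses :: "nat \<Rightarrow> 'a::comm_semiring_1 ext \<Rightarrow> 'a ext \<Rightarrow> bool" where
  "surpasses n x y \<longleftrightarrow> (\<exists>d. quasi_zero n d \<and> x = y + d)"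

lemma surpasses_if_separated:
  fixes x y :: "('m::comm_monoid_add \<Rightarrow>\<^sub>0 nat) ext"
  assumes "same_diff x y" "separated y" "supported (dkeys n {2..}) x"
  shows "surpasses n x y"
proof -
  let ?coeff = "\<lambda>x I p. Poly_Mapping.lookup (x (I, p) :: 'm \<Rightarrow>\<^sub>0 nat)"
  have balance: "?coeff x I p m + ?coeff y I (\<not> p) m = ?coeff y I p m + ?coeff x I (\<not> p) m"
      for I p m
    using arg_cong[OF assms(1)[unfolded same_diff_def], of "\<lambda>z. ?coeff z I p m"]
    by (simp add: plus_fun_apply lookup_add)
  have one_sign: "?coeff y I p m = 0 \<or> ?coeff y I (\<not> p) m = 0" for I p m
    using separatedD[OF assms(2), of m "(I, p)" "(I, \<not> p)"] by (auto simp: in_keys_iff)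
  have le: "?coeff y I p m \<le> ?coeff x I p m" for I p m
    using balance[of I p m] one_sign[of I p m] by linarith
  define d where "d K = x K - y K" for K
  have coeff_d: "?coeff d I p m = ?coeff x I p m - ?coeff y I p m" for I p m
    by (simp add: d_def minus_poly_mapping.rep_eq)
  have "x = y + d"
  proof (rule ext, clarify)
    fix I p
    show "x (I, p) = (y + d) (I, p)"
      by (rule poly_mapping_eqI) (simp add: plus_fun_apply lookup_add coeff_d le)
  qed
  moreover have "twist True d = d"
  proof (rule ext, clarify)
    fix I p
    have "?coeff x I (\<not> p) m - ?coeff y I (\<not> p) m = ?coeff x I p m - ?coeff y I p m" for m
      using balance[of I p m] le[of I p m] le[of I "\<not> p" m] by linarith
    then show "twist True d (I, p) = d (I, p)"
      by (intro poly_mapping_eqI) (simp add: coeff_d)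
  qed
  moreover have "d (I, p) = 0" if "x (I, p) = 0" for I p
    using that by (intro poly_mapping_eqI) (simp add: coeff_d)
  then have "supported (dkeys n {2..}) d" using assms(3) by (auto simp: supported_def)
  ultimately show ?thesis unfolding surpasses_def quasi_zero_def by blast
qed

lemma supported_signed_lhs:
  assumes "endo n f" "supported (dkeys n {1..}) u" "supported (dkeys n {1..}) v"
  shows "supported (dkeys n {2..}) (signed_lhs n f u v k)"
  unfolding signed_lhs_def
  by (intro supported_sum supported_signed_Dbar[OF assms(1)]
      supported_wedge[OF supported_signed_Dk[OF assms(1,2)] assms(3)]) auto

lemma surpasses_generic_basis:
  assumes "K \<in> dkeys n {1..}" "L \<in> dkeys n {1..}"
  shows "surpasses n (signed_lhs n (generic_endo n) (basis_ext K) (basis_ext L) k)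
    (signed_rhs n (generic_endo n) (basis_ext K) (basis_ext L) k)"
proof (rule surpasses_if_separated)
  obtain I p J q where KL: "K = (I, p)" "L = (J, q)" by (cases K; cases L)
  show "same_diff (signed_lhs n (generic_endo n) (basis_ext K) (basis_ext L) k)
      (signed_rhs n (generic_endo n) (basis_ext K) (basis_ext L) k)"
    using assms unfolding KL
    by (intro same_diff_signed_lhs_rhs_basis endo_generic_endo supported_basis_ext) simp_all
  show "separated (signed_rhs n (generic_endo n) (basis_ext K) (basis_ext L) k)"
    using assms(2) unfolding KL by (intro separated_signed_rhs_basis) simp
  show "supported (dkeys n {2..}) (signed_lhs n (generic_endo n) (basis_ext K) (basis_ext L) k)"
    using assms by (intro supported_signed_lhs endo_generic_endo supported_basis_ext)
qed

subsection \<open>Specialisation\<close>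

declare comp_apply [simp del]

locale semiring_hom =
  fixes h :: "'a::comm_semiring_1 \<Rightarrow> 'b::comm_semiring_1"
  assumes hom_zero: "h 0 = 0" and hom_one: "h 1 = 1"
    and hom_add: "h (x + y) = h x + h y" and hom_mult: "h (x * y) = h x * h y"
begin

lemma hom_sum: "h (\<Sum>i\<in>A. g i) = (\<Sum>i\<in>A. h (g i))"
  using sum_comp_morphism[of h g A] by (simp add: comp_def hom_zero hom_add)

lemma comp_zero: "h \<circ> 0 = 0"
  by (auto simp: fun_eq_iff comp_apply zero_fun_apply hom_zero)

lemma comp_add: "h \<circ> (x + y) = (h \<circ> x) + (h \<circ> y)"
  by (auto simp: fun_eq_iff comp_apply plus_fun_apply hom_add)

lemma comp_sum: "h \<circ> (\<Sum>i\<in>A. g i) = (\<Sum>i\<in>A. h \<circ> g i)"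
  by (auto simp: fun_eq_iff comp_apply sum_fun_apply hom_sum)

lemma comp_twist: "h \<circ> twist p x = twist p (h \<circ> x)"
  by (auto simp: fun_eq_iff comp_apply)

lemma comp_smult: "h \<circ> smult c x = smult (h c) (h \<circ> x)"
  by (auto simp: fun_eq_iff comp_apply smult_apply hom_mult)

lemma comp_wedge: "h \<circ> wedge x y = wedge (h \<circ> x) (h \<circ> y)"
  by (auto simp: fun_eq_iff comp_apply wedge_apply hom_sum hom_mult)

lemma comp_vec: "h \<circ> vec w = vec (h \<circ> w)"
  by (auto simp: fun_eq_iff comp_apply vec_def hom_zero)

lemma comp_bv: "h \<circ> bv i = bv i"
  by (auto simp: fun_eq_iff comp_apply bv_def hom_zero hom_one)

lemma comp_basis_ext: "h \<circ> basis_ext K = basis_ext K"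
  by (auto simp: fun_eq_iff comp_apply basis_ext_def hom_zero hom_one)

lemma comp_gone: "h \<circ> gone = gone"
  unfolding gone_eq_basis_ext by (rule comp_basis_ext)

lemma map_comp_basis_list: "map ((\<circ>) h) (basis_list I) = basis_list I"
  by (simp add: basis_list_def comp_apply comp_bv)

lemma comp_signed_lin:
  assumes "\<And>I. I \<subseteq> {..<n} \<Longrightarrow> h \<circ> g I = g' I"
  shows "h \<circ> signed_lin n g x = signed_lin n g' (h \<circ> x)"
  unfolding signed_lin_def comp_sum comp_smult comp_twist
  by (intro sum.cong refl) (auto simp: dkeys_def comp_apply assms)

lemma surpasses_comp:
  assumes "surpasses n x y"
  shows "surpasses n (h \<circ> x) (h \<circ> y)"
proof -
  obtain d where d: "twist True d = d" "supported (dkeys n {2..}) d" "x = y + d"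
    using assms unfolding surpasses_def quasi_zero_def by blast
  have "quasi_zero n (h \<circ> d)"
    using d(1,2) comp_twist[of True d]
    by (simp add: quasi_zero_def supported_def comp_apply hom_zero)
  then show ?thesis unfolding surpasses_def d(3) comp_add by blast
qed

end

locale semiring_hom_endo = semiring_hom +
  fixes n F f
  assumes endo_F: "endo n F" and endo_f: "endo n f"
    and comp_F_bv: "i < n \<Longrightarrow> h \<circ> F (bv i) = f (bv i)"
begin

lemma comp_F: "vin n w \<Longrightarrow> h \<circ> F w = f (h \<circ> w)"
proof (induction rule: vin_induct)
  case zero
  show ?case by (simp only: comp_zero endo_zero[OF endo_F] endo_zero[OF endo_f])
next
  case (add v w)
  then have "vin n (h \<circ> v)" "vin n (h \<circ> w)" by (auto simp: vin_def comp_apply hom_zero)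
  then show ?case using add by (simp only: comp_add endo_add[OF endo_F] endo_add[OF endo_f])
next
  case (smult_bv c i)
  have "h \<circ> F (\<lambda>l. c * bv i l) = (\<lambda>l. h c * (h \<circ> F (bv i)) l)"
    using smult_bv by (simp add: endo_smult[OF endo_F] vin_bv comp_def hom_mult)
  also have "\<dots> = f (\<lambda>l. h c * (h \<circ> bv i) l)"
    using smult_bv by (simp only: comp_F_bv comp_bv endo_smult[OF endo_f] vin_bv)
  finally show ?case by (simp add: comp_def hom_mult)
qed

lemma comp_funpow_F: "vin n w \<Longrightarrow> h \<circ> (F ^^ i) w = (f ^^ i) (h \<circ> w)"
proof (induction i)
  case (Suc i)
  then show ?case
    using comp_F[OF vin_funpow_endo[OF endo_F Suc.prems]]
    by (simp add: comp_apply[of f] comp_apply[of F])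
qed simp

lemma comp_HS: "(\<And>u. u \<in> set us \<Longrightarrow> vin n u) \<Longrightarrow> h \<circ> HS F k us = HS f k (map ((\<circ>) h) us)"
proof (induction us arbitrary: k)
  case (Cons u us)
  then show ?case
    by (simp add: comp_sum comp_wedge comp_vec comp_funpow_F)
qed (simp add: comp_gone comp_zero)

lemma comp_bar_list:
  "(\<And>u. u \<in> set us \<Longrightarrow> vin n u) \<Longrightarrow> h \<circ> bar_list F us j = bar_list f (map ((\<circ>) h) us) j"
proof (induction us arbitrary: j)
  case (Cons u us)
  then show ?case
    by (cases j) (simp_all add: bar_wedge_0 bar_wedge_Suc comp_add comp_twist comp_wedge comp_vec
      comp_F)
qed (simp add: comp_gone comp_zero)

lemma comp_signed_Dk: "h \<circ> signed_Dk n F k x = signed_Dk n f k (h \<circ> x)"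
  unfolding signed_Dk_def
  by (rule comp_signed_lin) (use comp_HS[OF vin_basis_list] in \<open>simp add: map_comp_basis_list\<close>)

lemma comp_signed_Dbar: "h \<circ> signed_Dbar n F j x = signed_Dbar n f j (h \<circ> x)"
  unfolding signed_Dbar_def
  by (rule comp_signed_lin)
    (use comp_bar_list[OF vin_basis_list] in \<open>simp add: map_comp_basis_list\<close>)

lemma comp_signed_lhs: "h \<circ> signed_lhs n F u v k = signed_lhs n f (h \<circ> u) (h \<circ> v) k"
  by (simp only: signed_lhs_def comp_sum comp_signed_Dbar comp_wedge comp_signed_Dk)

lemma comp_signed_rhs: "h \<circ> signed_rhs n F u v k = signed_rhs n f (h \<circ> u) (h \<circ> v) k"
  by (simp only: signed_rhs_def comp_signed_Dbar comp_wedge)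

end

definition eval_at :: "('m \<Rightarrow> 'a::comm_semiring_1) \<Rightarrow> ('m \<Rightarrow>\<^sub>0 nat) \<Rightarrow> 'a" where
  "eval_at \<phi> p = (\<Sum>m\<in>Poly_Mapping.keys p. of_nat (Poly_Mapping.lookup p m) * \<phi> m)"

lemma eval_at_add: "eval_at \<phi> (p + q) = eval_at \<phi> p + eval_at \<phi> q"
  unfolding eval_at_def by (rule setsum_keys_plus_distrib) (simp_all add: algebra_simps)

lemma eval_at_zero [simp]: "eval_at \<phi> 0 = 0"
  by (simp add: eval_at_def)

lemma eval_at_sum: "eval_at \<phi> (\<Sum>i\<in>A. p i) = (\<Sum>i\<in>A. eval_at \<phi> (p i))"
  using sum_comp_morphism[of "eval_at \<phi>" p A] by (simp add: eval_at_add comp_def)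

lemma eval_at_single: "eval_at \<phi> (Poly_Mapping.single m c) = of_nat c * \<phi> m"
  by (simp add: eval_at_def)

lemma poly_mapping_sum_single:
  "(\<Sum>m\<in>Poly_Mapping.keys p. Poly_Mapping.single m (Poly_Mapping.lookup p m)) = p"
  by (rule poly_mapping_eqI) (simp add: lookup_sum lookup_single when_def in_keys_iff)

lemma eval_at_mult:
  fixes \<phi> :: "'m::comm_monoid_add \<Rightarrow> 'a::comm_semiring_1"
  assumes "\<And>m m'. \<phi> (m + m') = \<phi> m * \<phi> m'"
  shows "eval_at \<phi> (p * q) = eval_at \<phi> p * eval_at \<phi> q"
proof -
  let ?term = "\<lambda>p m. Poly_Mapping.single m (Poly_Mapping.lookup p m) :: 'm \<Rightarrow>\<^sub>0 nat"
  have "p * q = (\<Sum>a\<in>Poly_Mapping.keys p. \<Sum>b\<in>Poly_Mapping.keys q. ?term p a * ?term q b)"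
    unfolding sum_product[symmetric] poly_mapping_sum_single ..
  also have "eval_at \<phi> \<dots> = (\<Sum>a\<in>Poly_Mapping.keys p. \<Sum>b\<in>Poly_Mapping.keys q.
      (of_nat (Poly_Mapping.lookup p a) * \<phi> a) * (of_nat (Poly_Mapping.lookup q b) * \<phi> b))"
    by (simp add: eval_at_sum mult_single eval_at_single assms algebra_simps)
  also have "\<dots> = eval_at \<phi> p * eval_at \<phi> q"
    unfolding eval_at_def sum_product ..
  finally show ?thesis .
qed

lemma semiring_hom_eval_at:
  assumes "\<phi> 0 = 1" "\<And>m m'. \<phi> (m + m') = \<phi> m * \<phi> m'"
  shows "semiring_hom (eval_at \<phi>)"
  by standard (simp_all add: eval_at_add eval_at_mult[OF assms(2)] eval_at_single assms(1)
    flip: single_one)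

definition matrix_eval :: "('a::comm_semiring_1 vect \<Rightarrow> 'a vect) \<Rightarrow> gpoly \<Rightarrow> 'a" where
  "matrix_eval f = eval_at (\<lambda>m. \<Prod>(l, j)\<in>#m. f (bv j) l)"

lemma semiring_hom_endo_matrix_eval:
  assumes "endo n f"
  shows "semiring_hom_endo (matrix_eval f) n (generic_endo n) f"
proof -
  interpret semiring_hom "matrix_eval f"
    unfolding matrix_eval_def by (rule semiring_hom_eval_at) simp_all
  have "matrix_eval f \<circ> generic_endo n (bv j) = f (bv j)" if "j < n" for j
  proof
    fix l
    have "vin n (f (bv j))" using that by (intro vin_endo[OF assms] vin_bv)
    then show "(matrix_eval f \<circ> generic_endo n (bv j)) l = f (bv j) l"
      using that
      by (simp add: generic_endo_bv comp_apply hom_zero vin_def)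
        (simp add: matrix_eval_def entry_var_def eval_at_single)
  qed
  then show ?thesis by unfold_locales (simp_all add: endo_generic_endo assms)
qed

lemma surpasses_signed_basis:
  assumes "endo n f" "K \<in> dkeys n {1..}" "L \<in> dkeys n {1..}"
  shows "surpasses n (signed_lhs n f (basis_ext K) (basis_ext L) k)
      (signed_rhs n f (basis_ext K) (basis_ext L) k)"
proof -
  interpret semiring_hom_endo "matrix_eval f" n "generic_endo n" f
    by (rule semiring_hom_endo_matrix_eval[OF assms(1)])
  show ?thesis
    using surpasses_comp[OF surpasses_generic_basis[OF assms(2,3), of k]]
    by (simp only: comp_signed_lhs comp_signed_rhs comp_basis_ext)
qed

subsection \<open>Bilinear extension\<close>

lemma surpasses_refl [simp]: "surpasses n x x"
  unfolding surpasses_def quasi_zero_def by (rule exI[of _ 0]) simp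

lemma surpasses_add:
  assumes "surpasses n x y" "surpasses n x' y'"
  shows "surpasses n (x + x') (y + y')"
proof -
  obtain d d' where d: "quasi_zero n d" "quasi_zero n d'" "x = y + d" "x' = y' + d'"
    using assms unfolding surpasses_def by blast
  have "quasi_zero n (d + d')" using d(1,2) by (simp add: quasi_zero_def twist_add supported_add)
  moreover have "x + x' = (y + y') + (d + d')" unfolding d(3,4) by (simp only: ac_simps)
  ultimately show ?thesis unfolding surpasses_def by blast
qed

lemma surpasses_smult:
  assumes "surpasses n x y"
  shows "surpasses n (smult c x) (smult c y)"
proof -
  obtain d where d: "quasi_zero n d" "x = y + d" using assms unfolding surpasses_def by blast
  have "quasi_zero n (smult c d)"
    using d(1) by (simp add: quasi_zero_def twist_smult supported_smult)
  then show ?thesis unfolding surpasses_def d(2) smult_add_right by blast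
qed

lemma signed_lhs_zero_left: "signed_lhs n f 0 v k = 0"
  and signed_lhs_zero_right: "signed_lhs n f u 0 k = 0"
  by (simp_all add: signed_lhs_def)

lemma signed_lhs_add_left:
    "signed_lhs n f (u + u') v k = signed_lhs n f u v k + signed_lhs n f u' v k"
  and signed_lhs_add_right:
    "signed_lhs n f u (v + v') k = signed_lhs n f u v k + signed_lhs n f u v' k"
  by (simp_all only: signed_lhs_def signed_Dk_add signed_Dbar_add wedge_add_left wedge_add_right
    sum.distrib)

lemma signed_lhs_smult_left: "signed_lhs n f (smult c u) v k = smult c (signed_lhs n f u v k)"
  and signed_lhs_smult_right: "signed_lhs n f u (smult c v) k = smult c (signed_lhs n f u v k)"
  by (simp_all only: signed_lhs_def signed_Dk_smult signed_Dbar_smult wedge_smult_left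
    wedge_smult_right smult_sum)

lemma signed_rhs_zero_left: "signed_rhs n f 0 v k = 0"
  and signed_rhs_zero_right: "signed_rhs n f u 0 k = 0"
  by (simp_all add: signed_rhs_def)

lemma signed_rhs_add_left:
    "signed_rhs n f (u + u') v k = signed_rhs n f u v k + signed_rhs n f u' v k"
  and signed_rhs_add_right:
    "signed_rhs n f u (v + v') k = signed_rhs n f u v k + signed_rhs n f u v' k"
  by (simp_all only: signed_rhs_def signed_Dbar_add wedge_add_left wedge_add_right)

lemma signed_rhs_smult_left: "signed_rhs n f (smult c u) v k = smult c (signed_rhs n f u v k)"
  and signed_rhs_smult_right: "signed_rhs n f u (smult c v) k = smult c (signed_rhs n f u v k)"
  by (simp_all only: signed_rhs_def signed_Dbar_smult wedge_smult_left
    wedge_smult_right)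

lemma surpasses_signed:
  assumes "endo n f" "supported (dkeys n {1..}) u" "supported (dkeys n {1..}) v"
  shows "surpasses n (signed_lhs n f u v k) (signed_rhs n f u v k)"
  using assms(2)
proof (induction rule: ext_induct)
  case zero
  show ?case by (simp add: signed_lhs_zero_left signed_rhs_zero_left)
next
  case (add u u')
  then show ?case by (simp add: signed_lhs_add_left signed_rhs_add_left surpasses_add)
next
  case (smult_basis c K)
  have "surpasses n (signed_lhs n f (basis_ext K) v k) (signed_rhs n f (basis_ext K) v k)"
    using assms(3)
  proof (induction rule: ext_induct)
    case zero
    show ?case by (simp add: signed_lhs_zero_right signed_rhs_zero_right)
  next
    case (add v v')
    then show ?case by (simp add: signed_lhs_add_right signed_rhs_add_right surpasses_add)
  next
    case (smult_basis d L)
    then show ?case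
      using surpasses_signed_basis[OF assms(1) \<open>K \<in> dkeys n {1..}\<close>]
      by (simp add: signed_lhs_smult_right signed_rhs_smult_right surpasses_smult)
  qed
  then show ?case by (simp add: signed_lhs_smult_left signed_rhs_smult_left surpasses_smult)
qed

lemma quasi_zero_in_qideal:
  assumes "quasi_zero n d"
  shows "d \<in> qideal n"
proof -
  have supp: "supported (dkeys n {2..}) d" and twist: "twist True d = d"
    using assms by (simp_all add: quasi_zero_def)
  define x where "x = (\<lambda>(I, p). if p then 0 else d (I, p))"
  have x: "supported (dkeys n {2..}) x" using supp by (simp add: supported_def x_def)
  have "gwf n x" "high x"
    using x by (auto simp: supported_def gwf_def high_def gkeys_def)
  moreover have "x + neg x = d"
  proof (rule ext, clarify)
    fix I p
    show "(x + neg x) (I, p) = d (I, p)"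
      unfolding neg_eq_twist[OF x] plus_fun_apply
      using fun_cong[OF twist, of "(I, True)"] by (cases p) (simp_all add: x_def)
  qed
  ultimately have "d \<in> qgens n" unfolding qgens_def by blast
  moreover have "gwf n (gone :: 'a ext)" by (auto simp: gwf_def gone_def gkeys_def)
  ultimately have "wedge (wedge gone d) gone \<in> qideal n" by (intro qgen)
  then show ?thesis by (simp add: wedge_gone_left[OF supp] wedge_gone_right[OF supp])
qed

lemma surpasses_imp_succeq: "surpasses n x y \<Longrightarrow> succeq n x y"
  unfolding surpasses_def succeq_def using quasi_zero_in_qideal by blast

lemma supported_positive_if_gwf:
  assumes "gwf n x" "x ({}, False) = 0"
  shows "supported (dkeys n {1..}) x"
  unfolding supported_def
proof (intro allI impI)
  fix K assume "K \<notin> dkeys n {1..}"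
  then consider "K \<notin> gkeys n" | "K = ({}, False)"
    using finite_subset[of "fst K" "{..<n}"]
    by (cases K; cases "snd K") (auto simp: gkeys_def Suc_le_eq card_gt_0_iff)
  then show "x K = 0" using assms(1)[unfolded gwf_def] assms(2) by cases blast+
qed

lemma lhs_coeff_eq_signed_lhs:
  assumes f: "endo n f" and "gwf n u"
    and u: "supported (dkeys n {1..}) u" and v: "supported (dkeys n {1..}) v"
  shows "lhs_coeff n f u v k = signed_lhs n f u v k"
proof -
  have "supported (dkeys n {2..}) (wedge (signed_Dk n f m u) v)" for m
    by (rule supported_wedge[OF supported_signed_Dk[OF f u] v]) auto
  then show ?thesis
    using assms(2)
    by (simp add: lhs_coeff_def signed_lhs_def Dk_eq_signed_Dk[OF f] Dbar_eq_signed_Dbar[OF f])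
qed

lemma signed_Dbar_eq_Dbar_add_vpart:
  assumes f: "endo n f" and "gwf n v" and v: "supported (dkeys n {1..}) v"
  shows "signed_Dbar n f k v = Dbar n f k v + signed_Dbar n f k (vec (vpart v))"
proof -
  define w where "w = (\<lambda>K. if 2 \<le> card (fst K) then v K else 0)"
  have "v K = (w + vec (vpart v)) K" for K
  proof (cases K)
    case (Pair I p)
    consider "2 \<le> card I" | "card I = 1" | "card I = 0" by linarith
    then show ?thesis
    proof cases
      case 2
      then show ?thesis using \<open>gwf n v\<close>
        by (auto simp: Pair plus_fun_apply w_def vec_def vpart_def gwf_def gkeys_def
          card_1_singleton_iff)
    next
      case 3
      then show ?thesis using v by (auto simp: Pair plus_fun_apply w_def vec_def supported_def)
    qed (simp add: Pair plus_fun_apply w_def vec_def)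
  qed
  then have "v = w + vec (vpart v)" ..
  moreover have "supported (dkeys n {2..}) w" using v by (auto simp: supported_def w_def)
  moreover have "Dbar n f k v = Dbar n f k w"
    unfolding Dbar_def by (intro sum.cong refl) (simp add: w_def)
  ultimately show ?thesis
    by (metis Dbar_eq_signed_Dbar[OF f] signed_Dbar_add)
qed

lemma rhs_coeff_eq_signed_rhs:
  assumes f: "endo n f" and u: "supported (dkeys n {1..}) u"
    and "gwf n v" and v: "supported (dkeys n {1..}) v"
  shows "rhs_coeff n f u v k = signed_rhs n f u v k"
proof -
  have vpart: "vin n (vpart v)" using \<open>gwf n v\<close> by (auto simp: vin_def vpart_def gwf_def gkeys_def)
  have "supported (dkeys n {2..}) (wedge u (vec (f (vpart v))))"
    by (rule supported_wedge[OF u supported_vec[OF vin_endo[OF f vpart]]]) auto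
  then have "neg (wedge u (vec (f (vpart v)))) = twist True (wedge u (vec (f (vpart v))))"
    by (rule neg_eq_twist)
  then show ?thesis
    using vpart
    by (simp add: rhs_coeff_def signed_rhs_def signed_Dbar_eq_Dbar_add_vpart[OF f \<open>gwf n v\<close> v]
      signed_Dbar_vec[OF f] wedge_add_right wedge_twist_right)
qed

theorem theorem3p5:
  fixes n :: nat and f :: "'a::comm_semiring_1 vect \<Rightarrow> 'a vect" and u v :: "'a ext"
  assumes "2 \<le> n"
    and "endo n f"
    and "gwf n u" and "u ({}, False) = 0"
    and "gwf n v" and "v ({}, False) = 0"
  shows "\<forall>k. succeq n (lhs_coeff n f u v k) (rhs_coeff n f u v k)"
proof
  fix k
  have u: "supported (dkeys n {1..}) u" using assms(3,4) by (rule supported_positive_if_gwf)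
  have v: "supported (dkeys n {1..}) v" using assms(5,6) by (rule supported_positive_if_gwf)
  have "succeq n (signed_lhs n f u v k) (signed_rhs n f u v k)"
    by (rule surpasses_imp_succeq[OF surpasses_signed[OF assms(2) u v]])
  then show "succeq n (lhs_coeff n f u v k) (rhs_coeff n f u v k)"
    unfolding lhs_coeff_eq_signed_lhs[OF assms(2,3) u v]
      rhs_coeff_eq_signed_rhs[OF assms(2) u assms(5) v] .
qed

end
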